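(* For all positive integers $k$, we have $$T_{ш}^{\mathcal S}(\{1\}^k)=\begin{cases}0,&k\text{ even},\\2\log2,&k=1,\\2(1-2^{1-k})\zeta(k),&k\ge2\text{ and }k\text{ odd}.\end{cases}$$ In particular, $$T_{ш}^{\mathcal S}(\{1\}^k)\equiv T_{ш}^{\mathcal S}(k)\pmod{\zeta(2)\,\mathsf{ES}^{(1)}_{k-2}}.$$
   Context: Notation: $\{1\}^k$ denotes the string $1,\dots,1$ of length $k$. $\zeta$ is the Riemann zeta function. $\mathsf{ES}^{(1)}_w$ is the $\mathbb Q$-vector space spanned by $\zeta(w)$ for $w\ge2$; by convention $\mathsf{ES}^{(1)}_0=\mathbb Q$ and $\mathsf{ES}^{(1)}_w=0$ for $w=1$ and $w<0$. A congruence modulo $\zeta(2)V$ means that the difference lies in $\{\zeta(2)v:v\in V\}$. Shuffle-regularized values: put $\omega_0=\frac{dt}{t}$, $\omega_1=\frac{2t\,dt}{1-t^2}$, $\omega_{-1}=\frac{2\,dt}{1-t^2}$. For a word $\eta_1\cdots\eta_m$ in these forms, $\eta_i=f_i(t)\,dt$, and $0<x\le1$, set $\int_0^x\eta_1\cdots\eta_m=\int_{x>t_1>\cdots>t_m>0}f_1(t_1)\cdots f_m(t_m)\,dt_1\cdots dt_m$. To a tuple of positive integers $\mathbf s=(s_1,\dots,s_d)$ associate the words $W_T(\mathbf s)=\omega_0^{s_1-1}\omega_{-1}\cdots\omega_0^{s_d-1}\omega_{-1}$ and $W_S(\mathbf s)=\omega_0^{s_1-1}\omega_{-1}\cdots\omega_0^{s_{d-1}-1}\omega_{-1}\,\omega_0^{s_d-1}\omega_1$.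 For $F\in\{S,T\}$, as $\epsilon\to0^+$ one has $\int_0^{1-\epsilon}W_F(\mathbf s)=P_{F,\mathbf s}(-\log\epsilon)+o(1)$ for a unique real polynomial $P_{F,\mathbf s}$; set $F_{ш}(\mathbf s)=P_{F,\mathbf s}(X)$, with $X$ a formal variable. If $s_1\ge2$ this is the constant $\int_0^1W_F(\mathbf s)$. For the empty index ($d=0$) set $F_{ш}=1$. Symmetric multiple $T$-values: $$T_{ш}^{\mathcal S}(s_1,\dots,s_d)=\begin{cases}\sum_{i=0}^d\big(\prod_{\ell=1}^i(-1)^{s_\ell}\big)T_{ш}(s_i,\dots,s_1)\,T_{ш}(s_{i+1},\dots,s_d), & d\text{ even},\\ \sum_{i=0}^d\big(\prod_{\ell=1}^i(-1)^{s_\ell}\big)S_{ш}(s_i,\dots,s_1)\,T_{ш}(s_{i+1},\dots,s_d), & d\text{ odd}.\end{cases}$$ This is a real number (it does not depend on $X$). *)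

theory Defs
  imports "HOL-Analysis.Analysis" "HOL-Computational_Algebra.Polynomial"
begin

text \<open>Meaningful for \<open>n \<ge> 2\<close> only, where the series converges.\<close>

definition zeta :: "nat \<Rightarrow> real" where
  "zeta n = (\<Sum>j. 1 / real (Suc j) ^ n)"

definition ES1 :: "int \<Rightarrow> real set" where
  "ES1 w = (if w = 0 then \<rat>
            else if w \<ge> 2 then {q * zeta (nat w) | q. q \<in> \<rat>}
            else {0})"

text \<open>A differential form \<open>f(t) dt\<close> is represented by its density \<open>f\<close>.\<close>

definition omega_0 :: "real \<Rightarrow> real" where
  "omega_0 t = 1 / t"

definition omega_1 :: "real \<Rightarrow> real" where
  "omega_1 t = 2 * t / (1 - t\<^sup>2)"

definition omega_minus_1 :: "real \<Rightarrow> real" where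
  "omega_minus_1 t = 2 / (1 - t\<^sup>2)"

text \<open>
  Coordinates are counted from \<open>0\<close>, so the first form of a word carries the largest variable:
  \<open>x > t 0 > \<dots> > t (m - 1) > 0\<close>.
\<close>

definition open_simplex :: "nat \<Rightarrow> real \<Rightarrow> (nat \<Rightarrow> real) set" where
  "open_simplex m x =
     {t. (\<forall>i<m. 0 < t i \<and> t i < x) \<and> (\<forall>i j. i < j \<and> j < m \<longrightarrow> t j < t i)}"

definition iter_integral :: "(real \<Rightarrow> real) list \<Rightarrow> real \<Rightarrow> real" where
  "iter_integral w x =
     (LINT t : open_simplex (length w) x | PiM {..<length w} (\<lambda>_. lborel).
        (\<Prod>i<length w. (w ! i) (t i)))"

definition word_T :: "nat list \<Rightarrow> (real \<Rightarrow> real) list" where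
  "word_T s = concat (map (\<lambda>n. replicate (n - 1) omega_0 @ [omega_minus_1]) s)"

text \<open>Used for nonempty indices only; the empty index is treated in \<open>S_sh\<close>.\<close>

definition word_S :: "nat list \<Rightarrow> (real \<Rightarrow> real) list" where
  "word_S s = word_T (butlast s) @ replicate (last s - 1) omega_0 @ [omega_1]"

text \<open>
  The shuffle regularization of a word: the polynomial in the formal variable \<open>X\<close> that gives the
  asymptotic expansion of the truncated integral at \<open>X = - ln \<epsilon>\<close>.
\<close>

definition reg_poly :: "(real \<Rightarrow> real) list \<Rightarrow> real poly" where
  "reg_poly w =
     (THE P. ((\<lambda>\<epsilon>. iter_integral w (1 - \<epsilon>) - poly P (- ln \<epsilon>)) \<longlongrightarrow> 0) (at_right 0))"

definition T_sh :: "nat list \<Rightarrow> real poly" where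
  "T_sh s = (if s = [] then 1 else reg_poly (word_T s))"

definition S_sh :: "nat list \<Rightarrow> real poly" where
  "S_sh s = (if s = [] then 1 else reg_poly (word_S s))"

text \<open>
  The symmetric multiple \<open>T\<close>-value, as an element of \<open>\<real>[X]\<close>; a real number \<open>c\<close> is identified with
  the constant polynomial \<open>[:c:]\<close>.
\<close>

definition T_sym :: "nat list \<Rightarrow> real poly" where
  "T_sym s =
     (if even (length s)
      then \<Sum>i=0..length s. smult (\<Prod>l<i. (- 1) ^ (s ! l)) (T_sh (rev (take i s)) * T_sh (drop i s))
      else \<Sum>i=0..length s. smult (\<Prod>l<i. (- 1) ^ (s ! l)) (S_sh (rev (take i s)) * T_sh (drop i s)))"

definition cong_zeta2 :: "real poly \<Rightarrow> real poly \<Rightarrow> real set \<Rightarrow> bool" where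
  "cong_zeta2 p q V \<longleftrightarrow> p - q \<in> {[:zeta 2 * v:] | v. v \<in> V}"

end

theory Submission
  imports Defs "HOL-Real_Asymp.Real_Asymp" "HOL-Computational_Algebra.Formal_Power_Series"
begin

text \<open>
  Put \<open>L(t) = log((1+t)/(1-t))\<close>, so that \<open>L' dt = \<omega>\<^sub>-\<^sub>1\<close>, and \<open>Li\<^sub>s(y) = \<Sum>\<^sub>n y\<^sup>n/n\<^sup>s\<close>. All the words that
  occur have the form \<open>f \<dots> f g\<close>, and for such a word the truncated integral is obtained by taking
  antiderivatives vanishing at \<open>0\<close>, starting from \<open>g\<close> and multiplying by \<open>f\<close> each time
  (\<open>iter_integral_replicate_append\<close>, by Tonelli's theorem). So it suffices to guess closed forms and
  differentiate them.

  \<^item> For \<open>\<omega>\<^sub>-\<^sub>1\<^sup>m\<close> the integral is \<open>L\<^sup>m/m!\<close>, and \<open>L(1-\<epsilon>) = - log \<epsilon> + log 2 + o(1)\<close>, whence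
    \<open>T({1}\<^sup>m) = E\<^sub>m\<close> with \<open>E\<^sub>m = (X + log 2)\<^sup>m/m!\<close>.

  \<^item> For \<open>\<omega>\<^sub>-\<^sub>1\<^sup>m\<^sup>-\<^sup>1\<omega>\<^sub>1\<close> put \<open>y = (1-t)/(1+t) = e\<^sup>-\<^sup>L\<close>. Since \<open>Li\<^sub>m(-y)\<close> has derivative
    \<open>- Li\<^sub>m\<^sub>-\<^sub>1(-y)\<close> with respect to \<open>L\<close>, it solves up to sign the same recursion as the iterated
    integrals; adding the right polynomial in \<open>L\<close> corrects the first step and the values at \<open>t = 0\<close>. The result is
    \<open>\<Sum>\<^sub>i (-1)\<^sup>i c\<^sub>i L\<^sup>m\<^sup>-\<^sup>i/(m-i)! + 2(-1)\<^sup>m Li\<^sub>m(-y)\<close> with \<open>c\<^sub>0 = 1\<close> and \<open>c\<^sub>i = -2 Li\<^sub>i(-1)\<close> for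
    \<open>i > 0\<close>. As \<open>t\<close> tends to \<open>1\<close>, \<open>y\<close> tends to \<open>0\<close> and the last term disappears, so
    \<open>S({1}\<^sup>m) = \<Sum>\<^sub>i (-1)\<^sup>i c\<^sub>i E\<^sub>m\<^sub>-\<^sub>i\<close>.

  In generating functions, \<open>\<Sum> E\<^sub>m z\<^sup>m = e\<^bsup>(X + log 2)z\<^esup>\<close> and \<open>\<Sum> (-1)\<^sup>m E\<^sub>m z\<^sup>m\<close> is its inverse. Hence the
  alternating convolution of the \<open>T\<close> with themselves is trivial, which is the case of even \<open>k\<close>, and that
  of the \<open>S\<close> with the \<open>T\<close> is \<open>c\<^sub>k\<close>, in which \<open>X\<close> has cancelled; this is the case of odd \<open>k\<close>, because
  \<open>-2 Li\<^sub>k(-1)\<close> is \<open>2 log 2\<close> for \<open>k = 1\<close> and \<open>2(1-2\<^sup>1\<^sup>-\<^sup>k)\<zeta>(k)\<close> otherwise.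

  In depth one, \<open>T(k)\<close> and \<open>S(k)\<close> are \<open>Li\<^sub>k(1) \<mp> Li\<^sub>k(-1)\<close>. So for odd \<open>k\<close> the symmetric value at \<open>(k)\<close>
  is again \<open>-2 Li\<^sub>k(-1)\<close> and the two sides of the congruence are equal, while for even \<open>k\<close> it is
  \<open>2\<zeta>(k)\<close>. For \<open>k = 2\<close> this is a rational multiple of \<open>\<zeta>(2)\<close>, as required; for \<open>k \<ge> 4\<close> one needs that
  \<open>\<zeta>(k)\<close> is a rational multiple of \<open>\<zeta>(2)\<zeta>(k-2)\<close>. This follows by induction from the identity \<open>\<Sum> \<zeta>(2j)\<zeta>(2n-2j) = (n + 1/2)\<zeta>(2n)\<close>, sum over \<open>0 < j < n\<close>
  (\<open>sum_zeta_products\<close>), which is proved by partial fractions on partial sums.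
\<close>

section \<open>Iterated integrals by successive antiderivatives\<close>

lemma product_sigma_finite_lborel: "product_sigma_finite (\<lambda>_. lborel)"
  by (simp add: product_sigma_finite_def sigma_finite_lborel)

lemma borel_measurable_component:
  assumes [measurable]: "\<phi> \<in> borel_measurable borel" and "i \<in> I"
  shows "(\<lambda>t. \<phi> (t i)) \<in> borel_measurable (PiM I (\<lambda>_. lborel :: real measure))"
  using assms(2) by measurable

lemma open_simplex_measurable [measurable]:
  "{t \<in> space (PiM {..<m} (\<lambda>_. lborel)). t \<in> open_simplex m x} \<in> sets (PiM {..<m} (\<lambda>_. lborel))"
proof -
  have eq: "t \<in> open_simplex m x \<longleftrightarrow>
      (\<forall>i\<in>{..<m}. 0 < t i \<and> t i < x) \<and> (\<forall>i\<in>{..<m}. \<forall>j\<in>{..<m}. i < j \<longrightarrow> t j < t i)" for t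
    unfolding open_simplex_def by auto
  show ?thesis
    unfolding eq by measurable
qed

text \<open>
  Forms that are nonnegative on the range of integration allow the passage to nonnegative Lebesgue
  integrals, where Tonelli's theorem asks for measurability alone.
\<close>

lemma iter_integral_eq_nn_integral:
  assumes "\<And>\<phi>. \<phi> \<in> set w \<Longrightarrow> \<phi> \<in> borel_measurable borel"
    and "\<And>\<phi> t. \<phi> \<in> set w \<Longrightarrow> 0 < t \<Longrightarrow> t < x \<Longrightarrow> 0 \<le> \<phi> t"
  shows "iter_integral w x = enn2real (\<integral>\<^sup>+ t. indicator (open_simplex (length w) x) t *
           ennreal (\<Prod>i<length w. (w ! i) (t i)) \<partial>PiM {..<length w} (\<lambda>_. lborel))"
proof -
  have [measurable]: "(\<lambda>t. (w ! i) (t i)) \<in> borel_measurable (PiM {..<length w} (\<lambda>_. lborel))"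
    if "i \<in> {..<length w}" for i
    using that by (intro borel_measurable_component assms(1)) auto
  have nonneg: "0 \<le> (\<Prod>i<length w. (w ! i) (t i))" if "t \<in> open_simplex (length w) x" for t
    using that by (intro prod_nonneg ballI assms(2)[OF nth_mem]) (auto simp: open_simplex_def)
  have "iter_integral w x = enn2real (\<integral>\<^sup>+ t. ennreal (indicator (open_simplex (length w) x) t *\<^sub>R
           (\<Prod>i<length w. (w ! i) (t i))) \<partial>PiM {..<length w} (\<lambda>_. lborel))"
    unfolding iter_integral_def set_lebesgue_integral_def
    by (intro integral_eq_nn_integral AE_I2) (auto simp: indicator_def nonneg)
  also have "(\<lambda>t. ennreal (indicator (open_simplex (length w) x) t *\<^sub>R (\<Prod>i<length w. (w ! i) (t i)))) =
      (\<lambda>t. indicator (open_simplex (length w) x) t * ennreal (\<Prod>i<length w. (w ! i) (t i)))"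
    by (auto simp: indicator_def)
  finally show ?thesis .
qed

text \<open>
  The smallest variable occurs only in its own form and in the bound by its predecessor; therefore
  it is the one that can be integrated out without renumbering the others.
\<close>

lemma open_simplex_Suc_Suc:
  "t(Suc n := y) \<in> open_simplex (Suc (Suc n)) x \<longleftrightarrow>
     t \<in> open_simplex (Suc n) x \<and> y \<in> {0<..<t n}"
proof
  assume *: "t(Suc n := y) \<in> open_simplex (Suc (Suc n)) x"
  have "0 < t i \<and> t i < x" if "i < Suc n" for i
    using * that unfolding open_simplex_def by (auto dest!: spec[of _ i])
  moreover have "t j < t i" if "i < j" "j < Suc n" for i j
  proof -
    from * have "\<forall>i j. i < j \<and> j < Suc (Suc n) \<longrightarrow> (t(Suc n := y)) j < (t(Suc n := y)) i"
      unfolding open_simplex_def by blast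
    then have "(t(Suc n := y)) j < (t(Suc n := y)) i"
      using that by (simp del: fun_upd_apply)
    then show ?thesis using that by auto
  qed
  moreover have "0 < (t(Suc n := y)) (Suc n)" "(t(Suc n := y)) (Suc n) < (t(Suc n := y)) n"
    using * unfolding open_simplex_def by (blast intro: lessI)+
  ultimately show "t \<in> open_simplex (Suc n) x \<and> y \<in> {0<..<t n}"
    unfolding open_simplex_def by auto
next
  assume *: "t \<in> open_simplex (Suc n) x \<and> y \<in> {0<..<t n}"
  then have "t n \<le> t i" if "i < Suc n" for i
    using that unfolding open_simplex_def by (cases "i = n") (auto simp: less_Suc_eq intro: less_imp_le)
  with * show "t(Suc n := y) \<in> open_simplex (Suc (Suc n)) x"
    unfolding open_simplex_def by (force simp: less_Suc_eq)
qed

text \<open>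
  Integrating out the smallest variable multiplies the preceding form by an antiderivative of the
  last one and shortens the word by one letter.
\<close>

lemma iter_integral_collapse:
  assumes w: "\<And>\<phi>. \<phi> \<in> set w \<Longrightarrow> \<phi> \<in> borel_measurable borel"
      "\<And>\<phi> t. \<phi> \<in> set w \<Longrightarrow> 0 < t \<Longrightarrow> t < x \<Longrightarrow> 0 \<le> \<phi> t"
    and f [measurable]: "f \<in> borel_measurable borel" and f0: "\<And>t. 0 < t \<Longrightarrow> t < x \<Longrightarrow> 0 \<le> f t"
    and h [measurable]: "h \<in> borel_measurable borel" and h0: "\<And>t. 0 < t \<Longrightarrow> t < x \<Longrightarrow> 0 \<le> h t"
    and H [measurable]: "H \<in> borel_measurable borel"
    and int: "\<And>s. 0 < s \<Longrightarrow> s < x \<Longrightarrow> (h has_integral H s) {0<..<s}"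
  shows "iter_integral (w @ [f, h]) x = iter_integral (w @ [\<lambda>t. f t * H t]) x"
proof -
  interpret product_sigma_finite "\<lambda>_::nat. lborel :: real measure"
    by (rule product_sigma_finite_lborel)
  define n where "n = length w"
  have H0: "0 \<le> H s" if "0 < s" "s < x" for s
    using has_integral_nonneg[OF int[OF that]] h0 that by auto
  have wm [measurable]: "(\<lambda>t. (w ! i) (t i)) \<in> borel_measurable (PiM {..<m} (\<lambda>_. lborel))"
    if "i \<in> {..<n}" "n \<le> m" for i m
    using that unfolding n_def by (intro borel_measurable_component w(1)) auto
  let ?W = "\<lambda>t. \<Prod>i<n. (w ! i) (t i)"
  let ?S = "\<lambda>m. indicator (open_simplex m x) :: (nat \<Rightarrow> real) \<Rightarrow> ennreal"
  have "iter_integral (w @ [f, h]) x = enn2real (\<integral>\<^sup>+ t. ?S (Suc (Suc n)) t *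
      ennreal (?W t * f (t n) * h (t (Suc n))) \<partial>PiM {..<Suc (Suc n)} (\<lambda>_. lborel))"
    by (subst iter_integral_eq_nn_integral)
      (use w f f0 h h0 in \<open>auto simp: n_def nth_append\<close>)
  also have "(\<integral>\<^sup>+ t. ?S (Suc (Suc n)) t *
      ennreal (?W t * f (t n) * h (t (Suc n))) \<partial>PiM {..<Suc (Suc n)} (\<lambda>_. lborel)) =
     (\<integral>\<^sup>+ t. \<integral>\<^sup>+ y. ?S (Suc (Suc n)) (t(Suc n := y)) *
      ennreal (?W (t(Suc n := y)) * f ((t(Suc n := y)) n) * h ((t(Suc n := y)) (Suc n))) \<partial>lborel
      \<partial>PiM {..<Suc n} (\<lambda>_. lborel))"
    unfolding lessThan_Suc[of "Suc n"]
  proof (rule product_nn_integral_insert)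
    show "(\<lambda>t. ?S (Suc (Suc n)) t * ennreal (?W t * f (t n) * h (t (Suc n))))
      \<in> borel_measurable (PiM (insert (Suc n) {..<Suc n}) (\<lambda>_. lborel))"
      unfolding lessThan_Suc[of "Suc n", symmetric] by measurable
  qed auto
  also have "\<dots> = (\<integral>\<^sup>+ t. ?S (Suc n) t * ennreal (?W t * (f (t n) * H (t n)))
      \<partial>PiM {..<Suc n} (\<lambda>_. lborel))"
  proof (rule nn_integral_cong)
    fix t :: "nat \<Rightarrow> real"
    have upd: "?W (t(Suc n := y)) = ?W t" for y
      by (intro prod.cong) auto
    show "(\<integral>\<^sup>+ y. ?S (Suc (Suc n)) (t(Suc n := y)) *
        ennreal (?W (t(Suc n := y)) * f ((t(Suc n := y)) n) * h ((t(Suc n := y)) (Suc n))) \<partial>lborel)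
      = ?S (Suc n) t * ennreal (?W t * (f (t n) * H (t n)))"
    proof (cases "t \<in> open_simplex (Suc n) x")
      case True
      then have tn: "0 < t n" "t n < x" by (auto simp: open_simplex_def)
      have "0 \<le> ?W t"
        using True unfolding n_def
        by (intro prod_nonneg ballI w(2)[OF nth_mem]) (auto simp: open_simplex_def)
      then have W0: "0 \<le> ?W t * f (t n)" using f0 tn by auto
      have "(\<integral>\<^sup>+ y. ?S (Suc (Suc n)) (t(Suc n := y)) *
        ennreal (?W (t(Suc n := y)) * f ((t(Suc n := y)) n) * h ((t(Suc n := y)) (Suc n))) \<partial>lborel)
        = (\<integral>\<^sup>+ y. ennreal (?W t * f (t n)) * ennreal (indicator {0<..<t n} y * h y) \<partial>lborel)"
        using True W0 tn unfolding upd
        by (intro nn_integral_cong)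
          (auto simp: indicator_def open_simplex_Suc_Suc ennreal_mult' simp del: fun_upd_apply
                simp: fun_upd_same fun_upd_other h0)
      also have "\<dots> = ennreal (?W t * f (t n)) * (\<integral>\<^sup>+ y. ennreal (indicator {0<..<t n} y * h y) \<partial>lborel)"
        by (rule nn_integral_cmult) simp
      also have "(\<integral>\<^sup>+ y. ennreal (indicator {0<..<t n} y * h y) \<partial>lborel) = H (t n)"
        by (rule nn_integral_has_integral_lebesgue) (use tn h0 int in auto)
      also have "ennreal (?W t * f (t n)) * ennreal (H (t n)) =
          ?S (Suc n) t * ennreal (?W t * (f (t n) * H (t n)))"
        using True W0 H0[OF tn] by (simp add: ennreal_mult'[symmetric] mult.assoc)
      finally show ?thesis .
    qed (auto simp: indicator_def open_simplex_Suc_Suc)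
  qed
  also have "enn2real \<dots> = iter_integral (w @ [\<lambda>t. f t * H t]) x"
    by (subst iter_integral_eq_nn_integral)
      (use w f f0 H H0 in \<open>auto simp: n_def nth_append\<close>)
  finally show ?thesis .
qed

lemma iter_integral_single:
  assumes [measurable]: "g \<in> borel_measurable borel" and g0: "\<And>t. 0 < t \<Longrightarrow> t < x \<Longrightarrow> 0 \<le> g t"
    and int: "(g has_integral I) {0<..<x}"
  shows "iter_integral [g] x = I"
proof -
  interpret product_sigma_finite "\<lambda>_::nat. lborel :: real measure"
    by (rule product_sigma_finite_lborel)
  have I: "0 \<le> I" using has_integral_nonneg[OF int] g0 by auto
  have "iter_integral [g] x = enn2real (\<integral>\<^sup>+ t. indicator (open_simplex 1 x) t *
           ennreal (g (t 0)) \<partial>PiM {0::nat} (\<lambda>_. lborel))"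
    by (subst iter_integral_eq_nn_integral) (use g0 in \<open>auto simp: lessThan_Suc\<close>)
  also have "(\<integral>\<^sup>+ t. indicator (open_simplex 1 x) t * ennreal (g (t 0)) \<partial>PiM {0::nat} (\<lambda>_. lborel))
     = (\<integral>\<^sup>+ t. (\<lambda>y. ennreal (indicator {0<..<x} y * g y)) (t 0) \<partial>PiM {0::nat} (\<lambda>_. lborel))"
    by (intro nn_integral_cong) (simp add: indicator_def open_simplex_def)
  also have "\<dots> = (\<integral>\<^sup>+ y. ennreal (indicator {0<..<x} y * g y) \<partial>lborel)"
    by (rule product_nn_integral_singleton) simp
  also have "\<dots> = I"
    by (rule nn_integral_has_integral_lebesgue) (use g0 int in auto)
  finally show ?thesis using I by simp
qed

text \<open>
  The tool for evaluating every iterated integral below: the word \<open>f \<dots> f g\<close> is collapsed from the right,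
  and \<open>G j\<close> is the factor that has accumulated after \<open>j + 1\<close> letters. Derivatives are required only in
  the interior, since forms such as \<open>dt/t\<close> are singular at \<open>0\<close>.
\<close>

lemma iter_integral_replicate_append:
  assumes [measurable]: "f \<in> borel_measurable borel" "g \<in> borel_measurable borel"
      "\<And>j. G j \<in> borel_measurable borel"
    and f0: "\<And>t. 0 < t \<Longrightarrow> t < x \<Longrightarrow> 0 \<le> f t" and g0: "\<And>t. 0 < t \<Longrightarrow> t < x \<Longrightarrow> 0 \<le> g t"
    and cont: "\<And>j. continuous_on {0..x} (G j)" and zero: "\<And>j. G j 0 = 0"
    and deriv0: "\<And>t. 0 < t \<Longrightarrow> t < x \<Longrightarrow> (G 0 has_real_derivative g t) (at t)"
    and deriv: "\<And>j t. 0 < t \<Longrightarrow> t < x \<Longrightarrow> (G (Suc j) has_real_derivative f t * G j t) (at t)"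
    and "0 < x"
  shows "iter_integral (replicate n f @ [g]) x = G n x"
  using assms(2,3) g0 cont zero deriv0 deriv
proof (induction n arbitrary: g G)
  case (0 g G)
  have "(g has_integral (G 0 x - G 0 0)) {0..x}"
    by (rule fundamental_theorem_of_calculus_interior)
      (use 0 \<open>0 < x\<close> in \<open>auto simp: has_real_derivative_iff_has_vector_derivative\<close>)
  then have "(g has_integral G 0 x) {0<..<x}"
    using 0 by (simp add: has_integral_Icc_iff_Ioo)
  with 0 show ?case by (auto intro!: iter_integral_single)
next
  case (Suc n g G)
  note [measurable] = Suc.prems(1,2)
  have int: "(g has_integral G 0 s) {0<..<s}" if s: "0 < s" "s < x" for s
  proof -
    have "(g has_integral (G 0 s - G 0 0)) {0..s}"
      by (rule fundamental_theorem_of_calculus_interior)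
        (use Suc.prems(6) s continuous_on_subset[OF Suc.prems(4)[of 0], of "{0..s}"]
          in \<open>auto simp: has_real_derivative_iff_has_vector_derivative\<close>)
    then show ?thesis
      using Suc by (simp add: has_integral_Icc_iff_Ioo)
  qed
  have G0: "0 \<le> G 0 s" if "0 < s" "s < x" for s
    using has_integral_nonneg[OF int[OF that]] Suc.prems(3) that by auto
  have "iter_integral (replicate (Suc n) f @ [g]) x = iter_integral (replicate n f @ [f, g]) x"
    by (simp flip: replicate_append_same)
  also have "\<dots> = iter_integral (replicate n f @ [\<lambda>t. f t * G 0 t]) x"
    by (rule iter_integral_collapse) (use Suc.prems(3) f0 int in auto)
  also have "\<dots> = G (Suc n) x"
    by (rule Suc.IH[of "\<lambda>t. f t * G 0 t" "\<lambda>j. G (Suc j)"]) (use f0 G0 Suc.prems in auto)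
  finally show ?case .
qed

section \<open>Shuffle regularization from an antiderivative\<close>

lemma poly_tendsto_0_at_top_imp_0:
  fixes p :: "real poly"
  assumes "(poly p \<longlongrightarrow> 0) at_top"
  shows "p = 0"
proof -
  have *: "\<not> lead_coeff q > 0" if "(poly q \<longlongrightarrow> 0) at_top" for q :: "real poly"
  proof
    assume pos: "lead_coeff q > 0"
    then obtain n where "\<forall>x\<ge>n. poly q x \<ge> lead_coeff q" using poly_pinfty_gt_lc by blast
    then have "\<forall>\<^sub>F x in at_top. poly q x \<ge> lead_coeff q"
      unfolding eventually_at_top_linorder by blast
    moreover have "\<forall>\<^sub>F x in at_top. poly q x < lead_coeff q"
      using order_tendstoD(2)[OF that pos] .
    ultimately have "\<forall>\<^sub>F x in at_top :: real filter. False"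
      by eventually_elim auto
    then show False by (simp add: trivial_limit_at_top_linorder)
  qed
  have "(poly (- p) \<longlongrightarrow> 0) at_top" using tendsto_minus[OF assms] by (simp add: poly_minus[abs_def])
  from *[OF assms] *[OF this] have "lead_coeff p = 0" by simp
  then show ?thesis by simp
qed

text \<open>
  The asymptotic expansion determines its polynomial, because \<open>- ln \<epsilon>\<close> tends to infinity and a nonzero
  polynomial does not tend to \<open>0\<close> there.
\<close>

lemma reg_poly_eqI:
  assumes "((\<lambda>\<epsilon>. iter_integral w (1 - \<epsilon>) - poly P (- ln \<epsilon>)) \<longlongrightarrow> 0) (at_right 0)"
  shows "reg_poly w = P"
  unfolding reg_poly_def
proof (rule the_equality)
  fix Q assume "((\<lambda>\<epsilon>. iter_integral w (1 - \<epsilon>) - poly Q (- ln \<epsilon>)) \<longlongrightarrow> 0) (at_right 0)"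
  from tendsto_diff[OF assms this]
  have "((\<lambda>\<epsilon>. poly (Q - P) (- ln \<epsilon>)) \<longlongrightarrow> 0) (at_right 0)" by simp
  moreover have "filterlim (\<lambda>x::real. exp (- x)) (at_right 0) at_top" by real_asymp
  ultimately have "((\<lambda>x. poly (Q - P) (- ln (exp (- x)))) \<longlongrightarrow> 0) at_top"
    by (rule filterlim_compose)
  then have "Q - P = 0" by (intro poly_tendsto_0_at_top_imp_0) (simp add: poly_diff[abs_def])
  then show "Q = P" by simp
qed (fact assms)

lemma reg_poly_of_antiderivative:
  assumes "\<And>x. 0 < x \<Longrightarrow> x < 1 \<Longrightarrow> iter_integral w x = A x"
    and "((\<lambda>\<epsilon>. A (1 - \<epsilon>) - poly P (- ln \<epsilon>)) \<longlongrightarrow> 0) (at_right 0)"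
  shows "reg_poly w = P"
proof (rule reg_poly_eqI, rule Lim_transform_eventually[OF assms(2)])
  have "\<forall>\<^sub>F \<epsilon> in at_right (0::real). \<epsilon> \<in> {0<..<1}"
    by (rule eventually_at_right_real) auto
  then show "\<forall>\<^sub>F \<epsilon> in at_right 0. A (1 - \<epsilon>) - poly P (- ln \<epsilon>) = iter_integral w (1 - \<epsilon>) - poly P (- ln \<epsilon>)"
    by eventually_elim (use assms(1) in auto)
qed

section \<open>Polylogarithms\<close>

lemma summable_inverse_power:
  assumes "k \<ge> 2"
  shows "summable (\<lambda>n. 1 / real (Suc n) ^ k)"
  using summable_Suc_iff[of "\<lambda>n. inverse (real n ^ k)"] inverse_power_summable[OF assms, where ?'a = real]
  by (simp only: inverse_eq_divide simp_thms)

definition polylog :: "nat \<Rightarrow> real \<Rightarrow> real" where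
  "polylog s y = (\<Sum>n. y ^ Suc n / real (Suc n) ^ s)"

lemma polylog_0_right [simp]: "polylog s 0 = 0"
  by (simp add: polylog_def)

lemma borel_measurable_polylog [measurable]: "polylog s \<in> borel_measurable borel"
  unfolding polylog_def[abs_def] by measurable

lemma summable_polylog:
  assumes "\<bar>y\<bar> < 1"
  shows "summable (\<lambda>n. y ^ Suc n / real (Suc n) ^ s)"
proof (rule summable_comparison_test)
  have "norm (y ^ Suc n / real (Suc n) ^ s) \<le> \<bar>y\<bar> ^ n" for n
  proof -
    have "1 \<le> real (Suc n) ^ s" by (rule one_le_power) simp
    then have "norm (y ^ Suc n / real (Suc n) ^ s) \<le> norm (y ^ Suc n)"
      unfolding norm_divide by (simp add: divide_le_eq mult_le_cancel_left1 del: of_nat_Suc power_Suc)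
    also have "\<dots> \<le> \<bar>y\<bar> ^ n"
      using assms by (simp add: norm_power abs_mult power_abs mult_left_le_one_le)
    finally show ?thesis .
  qed
  then show "\<exists>N. \<forall>n\<ge>N. norm (y ^ Suc n / real (Suc n) ^ s) \<le> \<bar>y\<bar> ^ n" by blast
  show "summable (\<lambda>n. \<bar>y\<bar> ^ n)" using assms by (intro summable_geometric) auto
qed

lemma polylog_0:
  assumes "\<bar>y\<bar> < 1"
  shows "polylog 0 y = y / (1 - y)"
proof -
  have "(\<lambda>n. y * y ^ n) sums (y * (1 / (1 - y)))"
    using assms by (intro sums_mult geometric_sums) auto
  then show ?thesis by (simp add: polylog_def sums_iff)
qed

text \<open>
  This is \<open>d Li\<^sub>s\<^sub>+\<^sub>1(y) = Li\<^sub>s(y) dy/y\<close>, the recursion behind all antiderivatives below that involve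
  polylogarithms.
\<close>

lemma polylog_deriv:
  assumes "\<bar>y\<bar> < 1" "y \<noteq> 0"
  shows "(polylog (Suc s) has_real_derivative polylog s y / y) (at y)"
proof -
  have eq: "1 / real (Suc n) ^ Suc s * real (Suc n) * y ^ n = y ^ Suc n / real (Suc n) ^ s / y"
    if "y \<noteq> 0" for y n
    using that by (simp add: field_simps del: of_nat_Suc)
  have summ: "summable (\<lambda>n. 1 / real (Suc n) ^ Suc s * real (Suc n) * y ^ n)"
    if "y \<in> {-1<..<1}" for y :: real
  proof (cases "y = 0")
    case False
    then show ?thesis
      using that unfolding eq[OF False] by (intro summable_divide summable_polylog) auto
  next
    case True
    show ?thesis unfolding True by (rule summable_finite[of "{0}"]) auto
  qed
  have "((\<lambda>x. \<Sum>n. 1 / real (Suc n) ^ Suc s * x ^ Suc n) has_real_derivative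
      (\<Sum>n. 1 / real (Suc n) ^ Suc s * real (Suc n) * y ^ n)) (at y)"
    by (rule DERIV_power_series'[where R = 1]) (use assms summ in auto)
  moreover have "(\<Sum>n. 1 / real (Suc n) ^ Suc s * real (Suc n) * y ^ n) = polylog s y / y"
    unfolding eq[OF assms(2)] polylog_def by (rule suminf_divide) (rule summable_polylog[OF assms(1)])
  ultimately show ?thesis by (simp add: polylog_def[abs_def])
qed

text \<open>
  At \<open>y = - 1\<close> the series converges only conditionally; there it is the alternating harmonic series.
\<close>

lemma polylog_1:
  assumes "- 1 \<le> y" "y < 1"
  shows "polylog 1 y = - ln (1 - y)"
proof (cases "y = - 1")
  case True
  have "(\<lambda>n. - ((-1) ^ n / real (Suc n))) sums - ln 2"
    by (intro sums_minus alternating_harmonic_series_sums)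
  then show ?thesis by (simp add: True polylog_def sums_iff)
next
  case False
  then have "ln (1 - y) = (\<Sum>n. (-1) ^ n * (1 / real (n + 1)) * ((1 - y) - 1) ^ Suc n)"
    using assms by (intro ln_series) auto
  also have "\<dots> = (\<Sum>n. - (y ^ Suc n / real (Suc n) ^ 1))"
  proof (intro suminf_cong)
    fix n
    have "(-1) ^ n * ((1 - y) - 1) ^ Suc n = - (((-1) * ((1 - y) - 1)) ^ Suc n)"
      by (simp only: power_mult_distrib) simp
    then show "(-1) ^ n * (1 / real (n + 1)) * ((1 - y) - 1) ^ Suc n = - (y ^ Suc n / real (Suc n) ^ 1)"
      by simp
  qed
  also have "\<dots> = - polylog 1 y"
    unfolding polylog_def by (rule suminf_minus) (use summable_polylog[of y 1] assms False in auto)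
  finally show ?thesis by simp
qed

lemma continuous_on_polylog_ge_2:
  assumes "s \<ge> 2"
  shows "continuous_on {- 1..1} (polylog s)"
  unfolding polylog_def[abs_def]
proof (rule uniform_limit_theorem)
  have "norm (y ^ Suc n / real (Suc n) ^ s) \<le> inverse (real (Suc n) ^ s)" if "y \<in> {-1..1}" for n y
  proof -
    have "\<bar>y\<bar> ^ Suc n \<le> 1" using that by (intro power_le_one) auto
    then show ?thesis
      by (simp add: norm_divide norm_power power_abs inverse_eq_divide divide_right_mono del: of_nat_Suc power_Suc)
  qed
  moreover have "summable (\<lambda>n. inverse (real (Suc n) ^ s))"
    using summable_inverse_power[OF assms] by (simp only: inverse_eq_divide)
  ultimately show "uniform_limit {- 1..1} (\<lambda>N y. \<Sum>n<N. y ^ Suc n / real (Suc n) ^ s)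
      (\<lambda>y. \<Sum>n. y ^ Suc n / real (Suc n) ^ s) sequentially"
    by (rule Weierstrass_m_test)
  show "\<forall>\<^sub>F N in sequentially. continuous_on {- 1..1} (\<lambda>y. \<Sum>n<N. y ^ Suc n / real (Suc n) ^ s)"
    by (intro always_eventually allI continuous_intros) auto
qed auto

text \<open>
  Continuity up to \<open>- 1\<close> matters since the initial value \<open>t = 0\<close> of the integrals corresponds to the
  argument \<open>- (1 - t)/(1 + t) = - 1\<close>.
\<close>

lemma continuous_on_polylog:
  assumes "s \<ge> 1"
  shows "continuous_on {- 1..<1} (polylog s)"
proof (cases "s = 1")
  case True
  have "continuous_on {- 1..<1} (\<lambda>y::real. - ln (1 - y))"
    by (intro continuous_intros) auto
  then show ?thesis
    unfolding True by (rule continuous_on_eq) (use polylog_1 in simp)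
next
  case False
  then show ?thesis
    using assms by (intro continuous_on_subset[OF continuous_on_polylog_ge_2]) auto
qed

lemma polylog_at_1: "polylog s 1 = zeta s"
  by (simp add: polylog_def zeta_def)

text \<open>
  In \<open>Li\<^sub>s(1) + Li\<^sub>s(-1)\<close> the terms with odd denominators cancel and those with even denominators are
  doubled, which gives \<open>2\<^bsup>1-s\<^esup> \<zeta>(s)\<close>.
\<close>

lemma polylog_at_minus_1:
  assumes "s \<ge> 2"
  shows "polylog s (- 1) = - (1 - 2 powi (1 - int s)) * zeta s"
proof -
  have summ: "summable (\<lambda>n. 1 / real (Suc n) ^ s)"
    by (rule summable_inverse_power[OF assms])
  then have summ': "summable (\<lambda>n. (- 1) ^ Suc n / real (Suc n) ^ s)"
    by (rule summable_comparison_test'[where N = 0]) (simp add: norm_divide norm_power del: of_nat_Suc power_Suc)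
  have "polylog s 1 + polylog s (- 1) = (\<Sum>n. 1 ^ Suc n / real (Suc n) ^ s + (- 1) ^ Suc n / real (Suc n) ^ s)"
    unfolding polylog_def by (rule suminf_add) (use summ summ' in simp_all)
  also have "\<dots> = (\<Sum>n. 1 ^ Suc (2 * n + 1) / real (Suc (2 * n + 1)) ^ s + (- 1) ^ Suc (2 * n + 1) / real (Suc (2 * n + 1)) ^ s)"
  proof (rule suminf_mono_reindex[symmetric])
    show "strict_mono (\<lambda>n::nat. 2 * n + 1)" by (auto simp: strict_mono_def)
    fix m :: nat assume "m \<notin> range (\<lambda>n. 2 * n + 1)"
    then have "even m" by (metis oddE rangeI)
    then show "1 ^ Suc m / real (Suc m) ^ s + (- 1) ^ Suc m / real (Suc m) ^ s = 0"
      by simp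
  qed
  also have "\<dots> = (\<Sum>n. 2 / 2 ^ s * (1 / real (Suc n) ^ s))"
  proof (rule suminf_cong)
    fix n
    have "real (Suc (2 * n + 1)) = 2 * real (Suc n)" by simp
    then have "real (Suc (2 * n + 1)) ^ s = 2 ^ s * real (Suc n) ^ s"
      by (simp only: power_mult_distrib)
    moreover have "(- 1 :: real) ^ Suc (2 * n + 1) = 1" by simp
    ultimately show "1 ^ Suc (2 * n + 1) / real (Suc (2 * n + 1)) ^ s + (- 1) ^ Suc (2 * n + 1) / real (Suc (2 * n + 1)) ^ s
        = 2 / 2 ^ s * (1 / real (Suc n) ^ s)"
      by (simp del: of_nat_Suc power_Suc)
  qed
  also have "\<dots> = 2 / 2 ^ s * zeta s"
    unfolding zeta_def by (rule suminf_mult[OF summ])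
  also have "2 / 2 ^ s = (2 powi (1 - int s) :: real)"
    by (simp add: power_int_diff)
  finally show ?thesis by (simp add: polylog_at_1 algebra_simps)
qed

section \<open>Even zeta values\<close>

definition zeta_partial :: "nat \<Rightarrow> nat \<Rightarrow> real" where
  "zeta_partial N s = (\<Sum>k=1..N. 1 / real k ^ s)"

lemma zeta_partial_tendsto:
  assumes "s \<ge> 2"
  shows "(\<lambda>N. zeta_partial N s) \<longlonglongrightarrow> zeta s"
proof -
  have "(\<lambda>n. 1 / real (Suc n) ^ s) sums zeta s"
    unfolding zeta_def by (rule summable_sums[OF summable_inverse_power[OF assms]])
  then have "(\<lambda>N. \<Sum>n<N. 1 / real (Suc n) ^ s) \<longlonglongrightarrow> zeta s"
    by (simp add: sums_def)
  also have "(\<lambda>N. \<Sum>n<N. 1 / real (Suc n) ^ s) = (\<lambda>N. zeta_partial N s)"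
    unfolding zeta_partial_def by (simp add: sum.atLeast1_atMost_eq)
  finally show ?thesis .
qed

lemma inverse_diff_squares:
  fixes x y :: real
  assumes "x \<noteq> y" "x \<noteq> - y" "y \<noteq> 0"
  shows "1 / (x\<^sup>2 - y\<^sup>2) = (1 / (x - y) - 1 / (x + y)) / (2 * y)"
proof -
  have "x - y \<noteq> 0" "x + y \<noteq> 0" using assms by auto
  moreover have "x\<^sup>2 - y\<^sup>2 = (x - y) * (x + y)" by (simp add: power2_eq_square algebra_simps)
  ultimately show ?thesis using assms(3) by (simp add: divide_simps)
qed

text \<open>
  The partial fraction decomposition turns the sum into harmonic numbers. The range \<open>N < k\<close>, in which
  the singular index \<open>m = k\<close> has not yet been reached, provides the initial value for
  \<open>sum_inverse_diff_squares\<close>.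
\<close>

lemma sum_inverse_diff_squares_below:
  assumes "N < k"
  shows "(\<Sum>m\<in>{1..N}. 1 / ((real m)\<^sup>2 - (real k)\<^sup>2)) =
    (harm k + harm (k - 1 - N) - harm (k - 1) - harm (N + k)) / (2 * real k)"
  using assms
proof (induction N)
  case (Suc N)
  define d where "d = k - 2 - N"
  have d: "k - 1 - N = Suc d" "k - 1 - Suc N = d" "real k = real d + real N + 2"
    using Suc.prems by (auto simp: d_def)
  have "1 / ((real (Suc N))\<^sup>2 - (real k)\<^sup>2) =
     (- inverse (real (Suc d)) - inverse (real (Suc N + k))) / (2 * real k)"
    using inverse_diff_squares[of "real (Suc N)" "real k"] d(3)
    by (simp add: inverse_eq_divide minus_divide_right flip: minus_divide_left)
  moreover have "harm (Suc N + k) = harm (N + k) + inverse (real (Suc N + k))"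
    by (simp add: harm_Suc)
  moreover have "harm (Suc d) = harm d + inverse (real (Suc d))"
    by (simp add: harm_Suc)
  ultimately show ?case
    using Suc d by (simp add: add_divide_distrib diff_divide_distrib)
qed auto

text \<open>
  As \<open>N\<close> tends to infinity this becomes the classical \<open>\<Sum>\<^bsub>m \<noteq> k\<^esub> 1/(m\<^sup>2 - k\<^sup>2) = 3/(4k\<^sup>2)\<close>; the exact error
  term is kept in order to control it uniformly in \<open>k\<close>.
\<close>

lemma sum_inverse_diff_squares:
  assumes "1 \<le> k" "k \<le> N"
  shows "(\<Sum>m\<in>{1..N} - {k}. 1 / ((real m)\<^sup>2 - (real k)\<^sup>2)) =
    3 / (4 * (real k)\<^sup>2) - (harm (N + k) - harm (N - k)) / (2 * real k)"
  using assms(2)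
proof (induction N rule: dec_induct)
  case base
  have [simp]: "harm 0 = (0::real)" by (simp add: harm_def)
  obtain j where j: "k = Suc j" using assms(1) by (cases k) auto
  have eq: "{1..k} - {k} = {1..k - 1}" using assms(1) by auto
  have h1: "harm k - harm (k - 1) = 1 / real k"
    unfolding j by (simp add: harm_Suc field_simps)
  have h2: "harm (k + k) = harm (k - 1 + k) + 1 / (2 * real k)"
    unfolding j by (simp add: harm_Suc field_simps)
  have "(\<Sum>m\<in>{1..k} - {k}. 1 / ((real m)\<^sup>2 - (real k)\<^sup>2)) =
    (harm k + harm (k - 1 - (k - 1)) - harm (k - 1) - harm (k - 1 + k)) / (2 * real k)"
    unfolding eq by (rule sum_inverse_diff_squares_below) (use assms in auto)
  also have "\<dots> = (1 / real k - harm (k + k) + 1 / (2 * real k)) / (2 * real k)"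
    using h1 h2 by simp
  also have "\<dots> = 3 / (4 * (real k)\<^sup>2) - (harm (k + k) - harm (k - k)) / (2 * real k)"
    using assms(1) by (simp add: field_simps power2_eq_square)
  finally show ?case .
next
  case (step N)
  define d where "d = N - k"
  have d: "Suc N - k = Suc d" "N - k = d" "real N = real d + real k"
    using step.hyps by (auto simp: d_def)
  have eq: "{1..Suc N} - {k} = insert (Suc N) ({1..N} - {k})"
    using step.hyps by auto
  have "1 / ((real (Suc N))\<^sup>2 - (real k)\<^sup>2) =
     (inverse (real (Suc d)) - inverse (real (Suc N + k))) / (2 * real k)"
    using inverse_diff_squares[of "real (Suc N)" "real k"] d(3) assms(1)
    by (simp add: inverse_eq_divide add_ac)
  moreover have "harm (Suc N + k) = harm (N + k) + inverse (real (Suc N + k))"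
    by (simp add: harm_Suc)
  moreover have "harm (Suc d) = harm d + inverse (real (Suc d))"
    by (simp add: harm_Suc)
  ultimately show ?case
    unfolding eq d(1) using step.IH step.hyps d(2) by (simp add: add_divide_distrib diff_divide_distrib)
qed

text \<open>
  A geometric sum, with the factor \<open>a b/(a - b)\<close> written as \<open>1/(1/b - 1/a)\<close>: for \<open>a = 1/k\<^sup>2\<close> and
  \<open>b = 1/m\<^sup>2\<close> the denominator becomes \<open>m\<^sup>2 - k\<^sup>2\<close>.
\<close>

lemma sum_powers_partial_fraction:
  fixes a b :: real
  assumes "a \<noteq> b" "a \<noteq> 0" "b \<noteq> 0" "n \<ge> 1"
  shows "(\<Sum>j=1..n-1. a ^ j * b ^ (n - j)) = (a ^ (n-1) - b ^ (n-1)) / (1 / b - 1 / a)"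
proof -
  obtain p where n: "n = Suc p" using assms(4) by (cases n) auto
  define S where "S = (\<Sum>i<p. b ^ (p - Suc i) * a ^ i)"
  have "(a - b) * S = a ^ p - b ^ p"
    unfolding S_def by (rule power_diff_sumr2[symmetric])
  moreover have "(\<Sum>j=1..n-1. a ^ j * b ^ (n - j)) = a * b * S"
    unfolding S_def n diff_Suc_1 One_nat_def sum.atLeast1_atMost_eq[unfolded One_nat_def] sum_distrib_left
  proof (rule sum.cong)
    fix i assume "i \<in> {..<p}"
    then have "Suc p - Suc i = Suc (p - Suc i)" by auto
    then show "a ^ Suc i * b ^ (Suc p - Suc i) = a * b * (b ^ (p - Suc i) * a ^ i)" by simp
  qed auto
  moreover have "1 / b - 1 / a = (a - b) / (a * b)" using assms by (simp add: field_simps)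
  ultimately show ?thesis using assms n by (simp flip: \<open>(a - b) * S = _\<close>)
qed

text \<open>
  Expand the products into double sums over \<open>k, m \<le> N\<close>. The diagonal gives \<open>n - 1\<close> times the partial sum
  of \<open>\<zeta>(2n)\<close>. Off the diagonal, each of the two terms of the partial fraction, summed first over the
  index that its numerator does not contain, gives \<open>3/4\<close> of the same partial sum up to an error.
\<close>

lemma sum_zeta_partial_products:
  assumes "n \<ge> 2"
  shows "(\<Sum>j=1..n-1. zeta_partial N (2 * j) * zeta_partial N (2 * (n - j))) =
    (real n + 1 / 2) * zeta_partial N (2 * n)
    - (\<Sum>k=1..N. (harm (N + k) - harm (N - k)) / real k ^ (2 * n - 1))"
proof -
  define a where "a = (\<lambda>k. 1 / (real k)\<^sup>2)"
  define D where "D = (\<lambda>k. \<Sum>m\<in>{1..N} - {k}. 1 / ((real m)\<^sup>2 - (real k)\<^sup>2))"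
  have zp: "zeta_partial N (2 * j) = (\<Sum>k=1..N. a k ^ j)" for j
    by (simp add: zeta_partial_def a_def power_mult power_one_over)
  have off: "(\<Sum>j=1..n-1. a k ^ j * a m ^ (n - j)) =
      a k ^ (n-1) / ((real m)\<^sup>2 - (real k)\<^sup>2) + a m ^ (n-1) / ((real k)\<^sup>2 - (real m)\<^sup>2)"
    if "k \<in> {1..N}" "m \<in> {1..N} - {k}" for k m
  proof -
    have ne: "(real k)\<^sup>2 \<noteq> (real m)\<^sup>2" using that by (auto simp: power2_eq_iff_nonneg)
    then have "(\<Sum>j=1..n-1. a k ^ j * a m ^ (n - j)) =
        (a k ^ (n-1) - a m ^ (n-1)) / (1 / a m - 1 / a k)"
      using that assms by (intro sum_powers_partial_fraction) (auto simp: a_def)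
    also have "1 / a m - 1 / a k = (real m)\<^sup>2 - (real k)\<^sup>2" by (simp add: a_def)
    also have "(a k ^ (n-1) - a m ^ (n-1)) / ((real m)\<^sup>2 - (real k)\<^sup>2) =
        a k ^ (n-1) / ((real m)\<^sup>2 - (real k)\<^sup>2) + a m ^ (n-1) / ((real k)\<^sup>2 - (real m)\<^sup>2)"
      using ne by (simp add: divide_simps) (simp add: algebra_simps)
    finally show ?thesis .
  qed
  have diag: "(\<Sum>j=1..n-1. a k ^ j * a k ^ (n - j)) = (real n - 1) * a k ^ n" for k
  proof -
    have "(\<Sum>j=1..n-1. a k ^ j * a k ^ (n - j)) = (\<Sum>j=1..n-1. a k ^ n)"
      by (intro sum.cong) (auto simp flip: power_add)
    then show ?thesis using assms by (simp add: of_nat_diff)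
  qed
  have "(\<Sum>j=1..n-1. zeta_partial N (2 * j) * zeta_partial N (2 * (n - j))) =
      (\<Sum>j=1..n-1. \<Sum>k=1..N. \<Sum>m=1..N. a k ^ j * a m ^ (n - j))"
    unfolding zp sum_product ..
  also have "\<dots> = (\<Sum>k=1..N. \<Sum>m=1..N. \<Sum>j=1..n-1. a k ^ j * a m ^ (n - j))"
    by (subst sum.swap) (intro sum.cong refl sum.swap)
  also have "\<dots> = (\<Sum>k=1..N. (real n - 1) * a k ^ n +
      (\<Sum>m\<in>{1..N} - {k}. a k ^ (n-1) / ((real m)\<^sup>2 - (real k)\<^sup>2) +
          a m ^ (n-1) / ((real k)\<^sup>2 - (real m)\<^sup>2)))"
  proof (intro sum.cong refl)
    fix k assume k: "k \<in> {1..N}"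
    show "(\<Sum>m=1..N. \<Sum>j=1..n-1. a k ^ j * a m ^ (n - j)) = (real n - 1) * a k ^ n +
      (\<Sum>m\<in>{1..N} - {k}. a k ^ (n-1) / ((real m)\<^sup>2 - (real k)\<^sup>2) +
          a m ^ (n-1) / ((real k)\<^sup>2 - (real m)\<^sup>2))"
      unfolding sum.remove[OF finite_atLeastAtMost k, of "\<lambda>m. \<Sum>j=1..n-1. a k ^ j * a m ^ (n - j)"] diag
      by (intro arg_cong2[of _ _ _ _ "(+)"] refl sum.cong off k)
  qed
  also have "\<dots> = (real n - 1) * zeta_partial N (2 * n) + (\<Sum>k=1..N. a k ^ (n-1) * D k) +
      (\<Sum>k=1..N. \<Sum>m\<in>{1..N} - {k}. a m ^ (n-1) / ((real k)\<^sup>2 - (real m)\<^sup>2))"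
    by (simp add: sum.distrib zp D_def sum_distrib_left)
  \<comment> \<open>by symmetry the second half of the partial fraction contributes the same as the first\<close>
  also have "(\<Sum>k=1..N. \<Sum>m\<in>{1..N} - {k}. a m ^ (n-1) / ((real k)\<^sup>2 - (real m)\<^sup>2)) =
      (\<Sum>m=1..N. \<Sum>k\<in>{1..N} - {m}. a m ^ (n-1) / ((real k)\<^sup>2 - (real m)\<^sup>2))"
  proof -
    have "(\<Sum>k=1..N. \<Sum>m\<in>{1..N} - {k}. F k m) = (\<Sum>m=1..N. \<Sum>k\<in>{1..N} - {m}. F k m)"
      for F :: "nat \<Rightarrow> nat \<Rightarrow> real"
    proof -
      have l: "{1..N} - {k} = {m. m \<in> {1..N} \<and> m \<noteq> k}" for k by auto
      have r: "{1..N} - {m} = {k. k \<in> {1..N} \<and> m \<noteq> k}" for m by auto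
      have "(\<Sum>k=1..N. \<Sum>m | m \<in> {1..N} \<and> m \<noteq> k. F k m) =
          (\<Sum>m=1..N. \<Sum>k | k \<in> {1..N} \<and> m \<noteq> k. F k m)"
        by (rule sum.swap_restrict) auto
      then show ?thesis unfolding l[symmetric] r[symmetric] .
    qed
    then show ?thesis .
  qed
  also have "\<dots> = (\<Sum>k=1..N. a k ^ (n-1) * D k)"
    by (simp add: D_def sum_distrib_left)
  also have "(\<Sum>k=1..N. a k ^ (n-1) * D k) = 3 / 4 * zeta_partial N (2 * n)
      - (\<Sum>k=1..N. (harm (N + k) - harm (N - k)) / real k ^ (2 * n - 1)) / 2"
  proof -
    have "a k ^ (n-1) * D k = 3 / 4 * a k ^ n - (harm (N + k) - harm (N - k)) / real k ^ (2 * n - 1) / 2"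
      if "k \<in> {1..N}" for k
    proof -
      obtain p where n: "n = Suc p" using assms by (cases n) auto
      have "D k = 3 / 4 * a k - (harm (N + k) - harm (N - k)) / (2 * real k)"
        using that sum_inverse_diff_squares[of k N] by (simp add: D_def a_def)
      moreover have "a k ^ p * (x / (2 * real k)) = x / real k ^ (2 * n - 1) / 2" for x
      proof -
        have "a k ^ p / real k = 1 / real k ^ (2 * n - 1)"
          by (simp add: n a_def power_mult power_one_over)
        moreover have "a k ^ p * (x / (2 * real k)) = x * (a k ^ p / real k) / 2"
          by (simp add: mult.commute)
        ultimately show ?thesis by simp
      qed
      ultimately show ?thesis
        by (simp only: n right_diff_distrib diff_Suc_1 power_Suc mult.commute mult.left_commute)
    qed
    then show ?thesis
      by (simp add: sum_subtractf zp sum_distrib_left sum_divide_distrib)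
  qed
  finally show ?thesis by (simp add: algebra_simps)
qed

lemma harm_over_n_tendsto_0: "(\<lambda>N. harm N / (real N + 1)) \<longlonglongrightarrow> (0::real)"
proof (rule tendsto_sandwich)
  show "\<forall>\<^sub>F N in sequentially. 0 \<le> harm N / (real N + 1)" by (simp add: harm_nonneg)
  show "\<forall>\<^sub>F N in sequentially. harm N / (real N + 1) \<le> (ln (real N) + 1) / (real N + 1)"
    using eventually_gt_at_top[of 0]
  proof eventually_elim
    case (elim N)
    then have "harm N \<le> ln (real N) + 1"
      using euler_mascheroni_sequence_decreasing[of 1 N] by (simp add: harm_expand)
    then show ?case by (intro divide_right_mono) auto
  qed
  show "(\<lambda>N. (ln (real N) + 1) / (real N + 1)) \<longlonglongrightarrow> 0" by real_asymp
qed auto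

lemma harm_diff_le: "harm (a + m) - harm a \<le> real m / (real a + 1)"
proof (induction m)
  case (Suc m)
  have "inverse (real (Suc (a + m))) \<le> 1 / (real a + 1)"
    unfolding inverse_eq_divide by (intro divide_left_mono) auto
  with Suc show ?case by (simp add: harm_Suc add_divide_distrib)
qed simp

text \<open>
  The error is at most \<open>4 H\<^sub>N/(N + 1)\<close>: the difference of harmonic numbers is at most
  \<open>2k/(N - k + 1)\<close>, and \<open>1/(k(N + 1 - k))\<close> is \<open>1/(N + 1)\<close> times \<open>1/k + 1/(N + 1 - k)\<close>.
\<close>

lemma zeta_partial_products_error:
  assumes "n \<ge> 2"
  shows "(\<lambda>N. \<Sum>k=1..N. (harm (N + k) - harm (N - k)) / real k ^ (2 * n - 1)) \<longlonglongrightarrow> (0::real)"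
proof (rule tendsto_sandwich)
  have nonneg: "0 \<le> harm (N + k) - (harm (N - k) :: real)" if "k \<le> N" for N k
    using harm_mono[of "N - k" "N + k", where ?'a = real] by simp
  show "\<forall>\<^sub>F N in sequentially.
      0 \<le> (\<Sum>k=1..N. (harm (N + k) - harm (N - k)) / real k ^ (2 * n - 1))"
    by (intro always_eventually allI sum_nonneg divide_nonneg_nonneg nonneg) auto
  have bound: "(harm (N + k) - harm (N - k)) / real k ^ (2 * n - 1) \<le>
      2 / (real N + 1) * (inverse (real k) + inverse (real (N + 1 - k)))"
    if "k \<in> {1..N}" for N k
  proof -
    define d where "d = N - k"
    have N: "N = d + k" "N + 1 - k = Suc d" using that by (auto simp: d_def)
    have "harm (N + k) - harm (N - k) \<le> 2 * real k / (real d + 1)"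
    proof -
      have "N + k = d + 2 * k" "N - k = d" by (simp_all add: N)
      then show ?thesis using harm_diff_le[of d "2 * k"] by (simp only: of_nat_mult of_nat_numeral)
    qed
    moreover have "real k ^ 2 \<le> real k ^ (2 * n - 1)"
      using that assms by (intro power_increasing) auto
    ultimately have "(harm (N + k) - harm (N - k)) / real k ^ (2 * n - 1) \<le>
        (2 * real k / (real d + 1)) / real k ^ 2"
      using nonneg[of k N] that by (intro frac_le) auto
    also have "\<dots> = 2 / (real N + 1) * (inverse (real k) + inverse (real (N + 1 - k)))"
    proof -
      have "inverse (real k) + inverse (real (Suc d)) = (real N + 1) / (real k * (real d + 1))"
        using that by (simp add: N(1) divide_simps add_ac)
      then show ?thesis
        using that unfolding N(2) \<open>inverse (real k) + _ = _\<close>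
        by (simp add: power2_eq_square divide_simps)
    qed
    finally show ?thesis .
  qed
  show "\<forall>\<^sub>F N in sequentially.
      (\<Sum>k=1..N. (harm (N + k) - harm (N - k)) / real k ^ (2 * n - 1)) \<le> 4 * (harm N / (real N + 1))"
  proof (intro always_eventually allI)
    fix N
    have rev: "(\<Sum>k=1..N. inverse (real (N + 1 - k))) = harm N"
      unfolding harm_def using sum.atLeastAtMost_rev[of "\<lambda>k. inverse (real k)" 1 N] by simp
    have "(\<Sum>k=1..N. (harm (N + k) - harm (N - k)) / real k ^ (2 * n - 1)) \<le>
        (\<Sum>k=1..N. 2 / (real N + 1) * (inverse (real k) + inverse (real (N + 1 - k))))"
      by (intro sum_mono bound) 
    also have "\<dots> = 2 / (real N + 1) * (harm N + harm N)"
      unfolding sum_distrib_left[symmetric] sum.distrib rev by (simp add: harm_def)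
    finally show "(\<Sum>k=1..N. (harm (N + k) - harm (N - k)) / real k ^ (2 * n - 1)) \<le>
       4 * (harm N / (real N + 1))" by simp
  qed
  show "(\<lambda>N. 4 * (harm N / (real N + 1))) \<longlonglongrightarrow> (0::real)"
    using tendsto_mult_right_zero[OF harm_over_n_tendsto_0] by blast
qed auto

lemma sum_zeta_products:
  assumes "n \<ge> 2"
  shows "(\<Sum>j=1..n-1. zeta (2 * j) * zeta (2 * (n - j))) = (real n + 1 / 2) * zeta (2 * n)"
proof (rule LIMSEQ_unique)
  show "(\<lambda>N. \<Sum>j=1..n-1. zeta_partial N (2 * j) * zeta_partial N (2 * (n - j))) \<longlonglongrightarrow>
      (\<Sum>j=1..n-1. zeta (2 * j) * zeta (2 * (n - j)))"
    by (intro tendsto_sum tendsto_mult zeta_partial_tendsto) auto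
  have "(\<lambda>N. (real n + 1 / 2) * zeta_partial N (2 * n)
    - (\<Sum>k=1..N. (harm (N + k) - harm (N - k)) / real k ^ (2 * n - 1))) \<longlonglongrightarrow>
     (real n + 1 / 2) * zeta (2 * n) - 0"
    using assms
    by (intro tendsto_diff tendsto_mult tendsto_const zeta_partial_tendsto zeta_partial_products_error) auto
  then show "(\<lambda>N. \<Sum>j=1..n-1. zeta_partial N (2 * j) * zeta_partial N (2 * (n - j))) \<longlonglongrightarrow>
     (real n + 1 / 2) * zeta (2 * n)"
    using sum_zeta_partial_products[OF assms] by simp
qed

lemma zeta_pos: "k \<ge> 2 \<Longrightarrow> zeta k > 0"
  unfolding zeta_def by (intro suminf_pos summable_inverse_power) auto

text \<open>
  By \<open>sum_zeta_products\<close> the normalized values \<open>\<zeta>(2n)/\<zeta>(2)\<^sup>n\<close> satisfy a convolution recursion with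
  rational coefficients, starting from the value \<open>1\<close> at \<open>n = 1\<close>.
\<close>

lemma zeta_even_rational:
  assumes "n \<ge> 1"
  shows "zeta (2 * n) / zeta 2 ^ n \<in> \<rat>"
  using assms
proof (induction n rule: less_induct)
  case (less n)
  have z: "zeta 2 > 0" by (rule zeta_pos) simp
  show ?case
  proof (cases "n = 1")
    case True
    then show ?thesis using z by simp
  next
    case False
    then have n: "n \<ge> 2" using less.prems by auto
    let ?r = "\<lambda>j. zeta (2 * j) / zeta 2 ^ j"
    have "(real n + 1 / 2) * ?r n = (\<Sum>j=1..n-1. zeta (2 * j) * zeta (2 * (n - j)) / zeta 2 ^ n)"
      unfolding sum_divide_distrib[symmetric] sum_zeta_products[OF n] by simp
    also have "\<dots> = (\<Sum>j=1..n-1. ?r j * ?r (n - j))"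
    proof (rule sum.cong)
      fix j assume j: "j \<in> {1..n-1}"
      then have "zeta 2 ^ n = zeta 2 ^ j * zeta 2 ^ (n - j)" by (auto simp flip: power_add)
      then show "zeta (2 * j) * zeta (2 * (n - j)) / zeta 2 ^ n = ?r j * ?r (n - j)" by simp
    qed auto
    finally have eq: "?r n = (\<Sum>j=1..n-1. ?r j * ?r (n - j)) / (real n + 1 / 2)"
      by (simp add: eq_divide_eq mult.commute)
    have "(\<Sum>j=1..n-1. ?r j * ?r (n - j)) \<in> \<rat>"
    proof (intro Rats_sum Rats_mult)
      fix j assume j: "j \<in> {1..n-1}"
      show "?r j \<in> \<rat>" by (rule less.IH) (use j in auto)
      show "?r (n - j) \<in> \<rat>" by (rule less.IH) (use j in auto)
    qed
    moreover have "real n + 1 / 2 \<in> \<rat>" by (intro Rats_add Rats_divide) auto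
    ultimately show ?thesis unfolding eq by (rule Rats_divide)
  qed
qed

lemma zeta_even_ratio:
  assumes "n \<ge> 2"
  shows "\<exists>q\<in>\<rat>. zeta (2 * n) = zeta 2 * (q * zeta (2 * n - 2))"
proof
  let ?r = "\<lambda>j. zeta (2 * j) / zeta 2 ^ j"
  show "?r n / ?r (n - 1) \<in> \<rat>"
    by (intro Rats_divide zeta_even_rational) (use assms in auto)
  have pos: "zeta 2 > 0" "zeta (2 * (n - 1)) > 0"
    using assms by (auto intro!: zeta_pos)
  have "zeta 2 ^ n = zeta 2 * zeta 2 ^ (n - 1)" using assms by (cases n) auto
  then show "zeta (2 * n) = zeta 2 * (?r n / ?r (n - 1) * zeta (2 * n - 2))"
    using pos by (simp add: right_diff_distrib')
qed

section \<open>The forms and the function log((1+t)/(1-t))\<close>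

lemma omega_measurable [measurable]:
  "omega_0 \<in> borel_measurable borel" "omega_1 \<in> borel_measurable borel"
  "omega_minus_1 \<in> borel_measurable borel"
  unfolding omega_0_def[abs_def] omega_1_def[abs_def] omega_minus_1_def[abs_def] by measurable

lemma omega_nonneg:
  assumes "0 < t" "t < 1"
  shows "0 \<le> omega_0 t" "0 \<le> omega_1 t" "0 \<le> omega_minus_1 t"
  using assms by (auto simp: omega_0_def omega_1_def omega_minus_1_def power_le_one)

definition log_ratio :: "real \<Rightarrow> real" where
  "log_ratio t = ln ((1 + t) / (1 - t))"

lemma borel_measurable_log_ratio [measurable]: "log_ratio \<in> borel_measurable borel"
  unfolding log_ratio_def[abs_def] by measurable

lemma log_ratio_0 [simp]: "log_ratio 0 = 0"
  by (simp add: log_ratio_def)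

lemma log_ratio_deriv:
  assumes "- 1 < t" "t < 1"
  shows "(log_ratio has_real_derivative omega_minus_1 t) (at t)"
proof -
  have "((\<lambda>t. ln (1 + t) - ln (1 - t)) has_real_derivative 1 / (1 + t) + 1 / (1 - t)) (at t)"
    using assms by (auto intro!: derivative_eq_intros)
  moreover have "1 / (1 + t) + 1 / (1 - t) = omega_minus_1 t"
  proof -
    have "1 - t\<^sup>2 = (1 + t) * (1 - t)" by (simp add: power2_eq_square algebra_simps)
    then show ?thesis using assms by (simp add: omega_minus_1_def field_simps)
  qed
  moreover have ev: "\<forall>\<^sub>F s in nhds t. ln (1 + s) - ln (1 - s) = log_ratio s"
    using eventually_nhds_in_open[of "{-1<..<1}" t] assms
    by (auto simp: log_ratio_def ln_div elim!: eventually_mono)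
  ultimately show ?thesis using DERIV_cong_ev[OF refl ev refl] by simp
qed

lemma continuous_on_log_ratio: "x < 1 \<Longrightarrow> continuous_on {0..x} log_ratio"
  by (intro continuous_at_imp_continuous_on ballI DERIV_isCont[OF log_ratio_deriv]) auto

lemma log_ratio_power_deriv:
  assumes "- 1 < t" "t < 1"
  shows "((\<lambda>t. log_ratio t ^ Suc j / fact (Suc j)) has_real_derivative
      omega_minus_1 t * (log_ratio t ^ j / fact j)) (at t)"
proof -
  have "((\<lambda>t. log_ratio t ^ Suc j / fact (Suc j)) has_real_derivative
      real (Suc j) * (omega_minus_1 t * log_ratio t ^ (Suc j - Suc 0)) / fact (Suc j)) (at t)"
    by (intro DERIV_cdivide DERIV_power log_ratio_deriv assms)
  then show ?thesis by (simp del: of_nat_Suc power_Suc)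
qed

section \<open>Regularized T-values at (1,...,1)\<close>

text \<open>
  The coefficients of \<open>e\<^bsup>(X + log 2)z\<^esup>\<close> as a power series in \<open>z\<close>.
\<close>

definition exp_poly :: "nat \<Rightarrow> real poly" where
  "exp_poly j = smult (1 / fact j) ([:ln 2, 1:] ^ j)"

lemma exp_poly_0 [simp]: "exp_poly 0 = 1"
  by (simp add: exp_poly_def)

text \<open>
  With \<open>b = log 2 - log \<epsilon>\<close> and \<open>d = L(1 - \<epsilon>) - b\<close>, the difference \<open>(b + d)\<^sup>j - b\<^sup>j\<close> tends to \<open>0\<close> although
  \<open>b\<close> is unbounded, because \<open>d\<close> is of order \<open>\<epsilon>\<close>, that is, of order \<open>e\<^sup>-\<^sup>b\<close>.
\<close>

lemma log_ratio_power_asymptotics: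
  "((\<lambda>\<epsilon>. log_ratio (1 - \<epsilon>) ^ j / fact j - poly (exp_poly j) (- ln \<epsilon>)) \<longlongrightarrow> 0) (at_right 0)"
proof -
  define b where "b = (\<lambda>\<epsilon>::real. ln 2 - ln \<epsilon>)"
  define d where "d = (\<lambda>\<epsilon>. log_ratio (1 - \<epsilon>) - b \<epsilon>)"
  have ev: "\<forall>\<^sub>F \<epsilon> in at_right (0::real). \<epsilon> \<in> {0<..<1}"
    by (rule eventually_at_right_real) auto
  have b_top: "filterlim b at_top (at_right 0)" unfolding b_def by real_asymp
  \<comment> \<open>the linear rate of \<open>d\<close>, expressed through \<open>\<epsilon> = 2 exp (- b)\<close>\<close>
  have d_over: "((\<lambda>\<epsilon>. d \<epsilon> / (2 * exp (- b \<epsilon>))) \<longlongrightarrow> - 1 / 2) (at_right 0)"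
  proof (rule Lim_transform_eventually)
    show "((\<lambda>\<epsilon>::real. ln (1 - \<epsilon> / 2) / \<epsilon>) \<longlongrightarrow> - 1 / 2) (at_right 0)" by real_asymp
    show "\<forall>\<^sub>F \<epsilon> in at_right 0. ln (1 - \<epsilon> / 2) / \<epsilon> = d \<epsilon> / (2 * exp (- b \<epsilon>))"
      using ev
    proof eventually_elim
      case (elim \<epsilon>)
      then have "ln (1 - \<epsilon> / 2) = ln ((2 - \<epsilon>) / 2)" by (simp add: field_simps)
      with elim show ?case
        by (simp add: d_def b_def log_ratio_def ln_div exp_diff)
    qed
  qed
  have d_power: "((\<lambda>\<epsilon>. d \<epsilon> * b \<epsilon> ^ n) \<longlongrightarrow> 0) (at_right 0)" for n
  proof -
    have "((\<lambda>\<epsilon>. b \<epsilon> ^ n / exp (b \<epsilon>)) \<longlongrightarrow> 0) (at_right 0)"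
      by (rule filterlim_compose[OF tendsto_power_div_exp_0 b_top])
    from tendsto_mult[OF d_over this] have "((\<lambda>\<epsilon>. d \<epsilon> * b \<epsilon> ^ n / 2) \<longlongrightarrow> 0) (at_right 0)"
      by (simp add: exp_minus field_simps)
    from tendsto_mult_right[OF this, of 2] show ?thesis by simp
  qed
  \<comment> \<open>the factor \<open>b ^ n\<close> makes the induction on \<open>j\<close> work\<close>
  have "((\<lambda>\<epsilon>. ((b \<epsilon> + d \<epsilon>) ^ j - b \<epsilon> ^ j) * b \<epsilon> ^ n) \<longlongrightarrow> 0) (at_right 0)" for j n
  proof (induction j arbitrary: n)
    case (Suc j)
    have "((\<lambda>\<epsilon>. ((b \<epsilon> + d \<epsilon>) ^ j - b \<epsilon> ^ j) * b \<epsilon> ^ Suc n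
        + d \<epsilon> * b \<epsilon> ^ 0 * (((b \<epsilon> + d \<epsilon>) ^ j - b \<epsilon> ^ j) * b \<epsilon> ^ n) + d \<epsilon> * b \<epsilon> ^ (j + n)) \<longlongrightarrow> 0 + 0 * 0 + 0)
        (at_right 0)"
      by (intro tendsto_add tendsto_mult Suc.IH d_power)
    then show ?case by (simp add: algebra_simps power_add)
  qed simp
  from this[of j 0] have "((\<lambda>\<epsilon>. (log_ratio (1 - \<epsilon>) ^ j - b \<epsilon> ^ j) / fact j) \<longlongrightarrow> 0) (at_right 0)"
    by (intro tendsto_divide_zero) (simp add: d_def)
  then show ?thesis
    by (simp add: exp_poly_def b_def diff_divide_distrib poly_power)
qed

lemma word_T_replicate_1: "word_T (replicate m 1) = replicate m omega_minus_1"
  by (induction m) (auto simp: word_T_def)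

lemma word_S_replicate_1: "word_S (replicate (Suc m) 1) = replicate m omega_minus_1 @ [omega_1]"
proof -
  have "butlast (replicate (Suc m) (1::nat)) = replicate m 1"
    by (simp flip: replicate_append_same)
  then show ?thesis unfolding word_S_def by (simp add: word_T_replicate_1 [simplified])
qed

lemma T_sh_replicate_1: "T_sh (replicate m 1) = exp_poly m"
proof (cases m)
  case (Suc n)
  have "reg_poly (replicate n omega_minus_1 @ [omega_minus_1]) = exp_poly m"
  proof (rule reg_poly_of_antiderivative[OF _ log_ratio_power_asymptotics])
    fix x :: real assume x: "0 < x" "x < 1"
    show "iter_integral (replicate n omega_minus_1 @ [omega_minus_1]) x = log_ratio x ^ m / fact m"
      unfolding Suc
    proof (rule iter_integral_replicate_append[where G = "\<lambda>j t. log_ratio t ^ Suc j / fact (Suc j)"])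
      fix t assume t: "0 < t" "t < x"
      show "((\<lambda>t. log_ratio t ^ Suc 0 / fact (Suc 0)) has_real_derivative omega_minus_1 t) (at t)"
        using log_ratio_power_deriv[of t 0] t x by simp
      show "((\<lambda>t. log_ratio t ^ Suc (Suc j) / fact (Suc (Suc j))) has_real_derivative
          omega_minus_1 t * (log_ratio t ^ Suc j / fact (Suc j))) (at t)" for j
        by (rule log_ratio_power_deriv) (use t x in auto)
    qed (use x in \<open>auto intro!: omega_nonneg continuous_intros continuous_on_log_ratio simp del: power_Suc fact_Suc\<close>)
  qed
  then show ?thesis
    unfolding T_sh_def word_T_replicate_1 by (simp add: Suc replicate_append_same)
qed (simp add: T_sh_def)

section \<open>Regularized S-values at (1,...,1)\<close>

text \<open>
  The constants \<open>c\<^sub>i\<close>: for \<open>i > 0\<close> twice the alternating zeta value \<open>1 - 1/2\<^sup>i + 1/3\<^sup>i - \<dots>\<close>. They enter as the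
  constants of integration of \<open>S_antideriv\<close>, and \<open>c\<^sub>k\<close> is also the symmetric value at \<open>({1}\<^sup>k)\<close> for odd \<open>k\<close>.
\<close>

definition sym_const :: "nat \<Rightarrow> real" where
  "sym_const i = (if i = 0 then 1 else - 2 * polylog i (- 1))"

text \<open>
  The closed form of the iterated integral of \<open>\<omega>\<^sub>-\<^sub>1\<^bsup>m-1\<^esup>\<omega>\<^sub>1\<close> for \<open>m > 0\<close>. For \<open>m = 0\<close> the formula reduces to \<open>t\<close>
  (\<open>S_antideriv_0\<close>), and \<open>t \<omega>\<^sub>-\<^sub>1 = \<omega>\<^sub>1\<close>; so one recursion covers also the step that produces the last
  letter.
\<close>

definition S_antideriv :: "nat \<Rightarrow> real \<Rightarrow> real" where
  "S_antideriv m t = (\<Sum>i\<le>m. (- 1) ^ i * sym_const i * (log_ratio t ^ (m - i) / fact (m - i)))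
     + 2 * (- 1) ^ m * polylog m (- ((1 - t) / (1 + t)))"

definition S_poly :: "nat \<Rightarrow> real poly" where
  "S_poly m = (\<Sum>i\<le>m. smult ((- 1) ^ i * sym_const i) (exp_poly (m - i)))"

lemma borel_measurable_S_antideriv [measurable]: "S_antideriv m \<in> borel_measurable borel"
  unfolding S_antideriv_def[abs_def] by measurable

text \<open>
  For \<open>y = (1 - t)/(1 + t)\<close> one has \<open>dy/y = - \<omega>\<^sub>-\<^sub>1\<close>, so the polylogarithm loses one unit of weight and
  changes its sign, as does the factor \<open>(-1)\<^sup>m\<close>.
\<close>

lemma S_antideriv_deriv:
  assumes "0 < t" "t < 1"
  shows "(S_antideriv (Suc m) has_real_derivative omega_minus_1 t * S_antideriv m t) (at t)"
proof -
  let ?y = "\<lambda>t::real. - ((1 - t) / (1 + t))"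
  have y: "\<bar>?y t\<bar> < 1" "?y t \<noteq> 0" using assms by (auto simp: field_simps)
  have dy: "(?y has_real_derivative 2 / (1 + t)\<^sup>2) (at t)"
    using assms by (auto intro!: derivative_eq_intros simp: field_simps power2_eq_square)
  have "2 / (1 + t)\<^sup>2 = - ?y t * omega_minus_1 t"
  proof -
    have "1 - t\<^sup>2 = (1 + t) * (1 - t)" by (simp add: power2_eq_square algebra_simps)
    then show ?thesis using assms by (simp add: omega_minus_1_def divide_simps) (simp add: power2_eq_square)
  qed
  then have "polylog m (?y t) / ?y t * (2 / (1 + t)\<^sup>2) = - (omega_minus_1 t * polylog m (?y t))"
    using y(2) by simp
  with DERIV_chain2[OF polylog_deriv[OF y, of m] dy]
  have dp: "((\<lambda>t. polylog (Suc m) (?y t)) has_real_derivative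
      - (omega_minus_1 t * polylog m (?y t))) (at t)"
    by (simp only:)
  have ds: "((\<lambda>t. log_ratio t ^ (Suc m - i) / fact (Suc m - i)) has_real_derivative
      omega_minus_1 t * (log_ratio t ^ (m - i) / fact (m - i))) (at t)" if "i \<le> m" for i
    unfolding Suc_diff_le[OF that] by (rule log_ratio_power_deriv) (use assms in auto)
  have eq: "S_antideriv (Suc m) = (\<lambda>t. (\<Sum>i\<le>m. (- 1) ^ i * sym_const i *
       (log_ratio t ^ (Suc m - i) / fact (Suc m - i)))
       + (- 1) ^ Suc m * sym_const (Suc m) + 2 * (- 1) ^ Suc m * polylog (Suc m) (?y t))"
    unfolding S_antideriv_def[abs_def] by simp
  have "(S_antideriv (Suc m) has_real_derivative
      (\<Sum>i\<le>m. (- 1) ^ i * sym_const i * (omega_minus_1 t * (log_ratio t ^ (m - i) / fact (m - i))))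
      + 0 + 2 * (- 1) ^ Suc m * - (omega_minus_1 t * polylog m (?y t))) (at t)"
    unfolding eq by (intro DERIV_add DERIV_sum DERIV_cmult dp ds DERIV_const) auto
  also have "(\<Sum>i\<le>m. (- 1) ^ i * sym_const i * (omega_minus_1 t * (log_ratio t ^ (m - i) / fact (m - i))))
      + 0 + 2 * (- 1) ^ Suc m * - (omega_minus_1 t * polylog m (?y t)) = omega_minus_1 t * S_antideriv m t"
    unfolding S_antideriv_def by (simp add: distrib_left sum_distrib_left mult_ac)
  finally show ?thesis .
qed

lemma S_antideriv_0:
  assumes "0 < t" "t < 1"
  shows "S_antideriv 0 t = t"
proof -
  have "\<bar>- ((1 - t) / (1 + t))\<bar> < 1" using assms by (auto simp: field_simps)
  then show ?thesis
    using assms by (simp add: S_antideriv_def sym_const_def polylog_0 field_simps)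
qed

text \<open>
  At \<open>t = 0\<close> one has \<open>L = 0\<close> and \<open>y = 1\<close>; the constant \<open>c\<^sub>m\<^sub>+\<^sub>1 = -2 Li\<^sub>m\<^sub>+\<^sub>1(-1)\<close> is chosen such that it
  cancels the polylogarithm there.
\<close>

lemma S_antideriv_Suc_at_0: "S_antideriv (Suc m) 0 = 0"
proof -
  have "(\<Sum>i\<le>m. (- 1) ^ i * sym_const i * ((0::real) ^ (Suc m - i) / fact (Suc m - i))) = 0"
    by (intro sum.neutral) (auto simp: power_0_left)
  then show ?thesis by (simp add: S_antideriv_def sym_const_def)
qed

lemma continuous_on_S_antideriv:
  assumes "x < 1"
  shows "continuous_on {0..x} (S_antideriv (Suc m))"
  unfolding S_antideriv_def[abs_def]
proof (intro continuous_intros continuous_on_log_ratio assms)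
  show "continuous_on {0..x} (\<lambda>t. polylog (Suc m) (- ((1 - t) / (1 + t))))"
  proof (rule continuous_on_compose2[OF continuous_on_polylog])
    show "continuous_on {0..x} (\<lambda>t::real. - ((1 - t) / (1 + t)))"
      by (intro continuous_intros) auto
    show "(\<lambda>t. - ((1 - t) / (1 + t))) ` {0..x} \<subseteq> {- 1..<1}"
      using assms by (auto simp: field_simps)
  qed auto
qed auto

text \<open>
  The polylogarithm tends to \<open>Li(0) = 0\<close>, so only the powers of \<open>L\<close> contribute to the expansion.
\<close>

lemma S_antideriv_asymptotics:
  "((\<lambda>\<epsilon>. S_antideriv (Suc m) (1 - \<epsilon>) - poly (S_poly (Suc m)) (- ln \<epsilon>)) \<longlongrightarrow> 0) (at_right 0)"
proof -
  have "isCont (polylog (Suc m)) 0"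
    using continuous_on_interior[OF continuous_on_polylog, of "Suc m" 0] by simp
  then have "(polylog (Suc m) \<longlongrightarrow> 0) (nhds 0)"
    by (simp add: isCont_def tendsto_nhds_iff)
  moreover have "filterlim (\<lambda>\<epsilon>::real. - ((1 - (1 - \<epsilon>)) / (1 + (1 - \<epsilon>)))) (nhds 0) (at_right 0)"
    by real_asymp
  ultimately have "((\<lambda>\<epsilon>. polylog (Suc m) (- ((1 - (1 - \<epsilon>)) / (1 + (1 - \<epsilon>))))) \<longlongrightarrow> 0) (at_right 0)"
    by (rule filterlim_compose)
  then have "((\<lambda>\<epsilon>. (\<Sum>i\<le>Suc m. (- 1) ^ i * sym_const i * (log_ratio (1 - \<epsilon>) ^ (Suc m - i) / fact (Suc m - i)
         - poly (exp_poly (Suc m - i)) (- ln \<epsilon>)))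
      + 2 * (- 1) ^ Suc m * polylog (Suc m) (- ((1 - (1 - \<epsilon>)) / (1 + (1 - \<epsilon>))))) \<longlongrightarrow> 0 + 0) (at_right 0)"
    by (intro tendsto_add tendsto_null_sum tendsto_mult_right_zero log_ratio_power_asymptotics)
  then show ?thesis
    unfolding S_antideriv_def S_poly_def poly_sum poly_smult right_diff_distrib sum_subtractf
    by (simp only: diff_add_eq add_0_right)
qed

lemma S_sh_replicate_1: "S_sh (replicate m 1) = S_poly m"
proof (cases m)
  case (Suc n)
  have "reg_poly (word_S (replicate (Suc n) 1)) = S_poly (Suc n)"
    unfolding word_S_replicate_1
  proof (rule reg_poly_of_antiderivative[OF _ S_antideriv_asymptotics])
    fix x :: real assume x: "0 < x" "x < 1"
    show "iter_integral (replicate n omega_minus_1 @ [omega_1]) x = S_antideriv (Suc n) x"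
    proof (rule iter_integral_replicate_append[where G = "\<lambda>j. S_antideriv (Suc j)"])
      fix t assume t: "0 < t" "t < x"
      show "(S_antideriv (Suc 0) has_real_derivative omega_1 t) (at t)"
        using S_antideriv_deriv[of t 0] S_antideriv_0[of t] t x
        by (simp add: omega_1_def omega_minus_1_def)
      show "(S_antideriv (Suc (Suc j)) has_real_derivative omega_minus_1 t * S_antideriv (Suc j) t) (at t)" for j
        by (rule S_antideriv_deriv) (use t x in auto)
    qed (use x in \<open>auto intro!: omega_nonneg continuous_on_S_antideriv S_antideriv_Suc_at_0\<close>)
  qed
  then show ?thesis
    by (simp add: S_sh_def Suc)
qed (simp add: S_sh_def S_poly_def sym_const_def)

section \<open>Symmetric values at (1,...,1)\<close>

lemma smult_sum_right: "smult c (sum f A) = (\<Sum>i\<in>A. smult c (f i))"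
  by (induction A rule: infinite_finite_induct) (simp_all add: smult_add_right)

text \<open>
  The binomial theorem for \<open>(-Y + Y)\<^sup>n\<close> with \<open>Y = X + log 2\<close>.
\<close>

lemma exp_poly_convolution:
  "(\<Sum>i=0..n. smult ((- 1) ^ i) (exp_poly i) * exp_poly (n - i)) = (if n = 0 then 1 else 0)"
proof -
  let ?Y = "[:ln 2, 1:] :: real poly"
  have "(\<Sum>i=0..n. smult ((- 1) ^ i) (exp_poly i) * exp_poly (n - i)) =
      (\<Sum>i=0..n. smult (1 / fact n) (of_nat (n choose i) * (- ?Y) ^ i * ?Y ^ (n - i)))"
  proof (rule sum.cong)
    fix i assume "i \<in> {0..n}"
    then have b: "real (n choose i) = fact n / (fact i * fact (n - i))"
      by (intro binomial_fact) auto
    have "(- ?Y) ^ i = smult ((- 1) ^ i) (?Y ^ i)"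
      by (metis smult_power smult_minus_left smult_1_left)
    moreover have "of_nat (n choose i) = [:real (n choose i):]" by (simp add: of_nat_poly)
    ultimately show "smult ((- 1) ^ i) (exp_poly i) * exp_poly (n - i) =
        smult (1 / fact n) (of_nat (n choose i) * (- ?Y) ^ i * ?Y ^ (n - i))"
      by (simp add: exp_poly_def b mult.commute)
  qed auto
  also have "\<dots> = smult (1 / fact n) ((- ?Y + ?Y) ^ n)"
    unfolding binomial_ring smult_sum_right by (simp add: atLeast0AtMost)
  also have "\<dots> = (if n = 0 then 1 else 0)"
    by (simp add: power_0_left)
  finally show ?thesis .
qed

text \<open>
  In power series over \<open>\<real>[X]\<close>: the signed \<open>S\<close>-polynomials are the product of the constants \<open>c\<^sub>i\<close> with the
  inverse of the series of the \<open>E\<^sub>i\<close>, and multiplication by the latter leaves the constants.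
\<close>

lemma S_poly_convolution:
  "(\<Sum>i=0..n. smult ((- 1) ^ i) (S_poly i * exp_poly (n - i))) = [:sym_const n:]"
proof -
  define C where "C = Abs_fps (\<lambda>i. [:sym_const i:])"
  define E where "E = Abs_fps exp_poly"
  define E' where "E' = Abs_fps (\<lambda>i. smult ((- 1) ^ i) (exp_poly i))"
  define S' where "S' = Abs_fps (\<lambda>i. smult ((- 1) ^ i) (S_poly i))"
  have "E' * E = 1"
    by (rule fps_ext) (simp add: fps_mult_nth E_def E'_def exp_poly_convolution del: mult_smult_left)
  moreover have "S' = C * E'"
  proof (rule fps_ext)
    fix n
    have "smult ((- 1) ^ n) (S_poly n) = (\<Sum>i\<le>n. [:sym_const i:] * smult ((- 1) ^ (n - i)) (exp_poly (n - i)))"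
      unfolding S_poly_def smult_sum_right
    proof (rule sum.cong)
      fix i assume "i \<in> {..n}"
      then have "(- 1 :: real) ^ n = (- 1) ^ (n - i) * (- 1) ^ i" by (simp flip: power_add)
      then have sign: "(- 1 :: real) ^ n * ((- 1) ^ i * sym_const i) = (- 1) ^ (n - i) * sym_const i"
        by (simp add: mult_ac flip: power_mult_distrib)
      then show "smult ((- 1) ^ n) (smult ((- 1) ^ i * sym_const i) (exp_poly (n - i))) =
          [:sym_const i:] * smult ((- 1) ^ (n - i)) (exp_poly (n - i))"
        unfolding smult_smult sign by simp
    qed auto
    then show "fps_nth S' n = fps_nth (C * E') n"
      by (simp add: S'_def C_def E'_def fps_mult_nth atLeast0AtMost)
  qed
  ultimately have "S' * E = C" by (simp add: mult.assoc)
  then have "fps_nth (S' * E) n = fps_nth C n" by simp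
  then show ?thesis by (simp add: fps_mult_nth S'_def E_def C_def)
qed

lemma T_sym_replicate_1:
  "T_sym (replicate k 1) = (if even k then if k = 0 then 1 else 0 else [:sym_const k:])"
proof -
  have sign: "(\<Prod>l<i. (- 1 :: real) ^ (replicate k 1 ! l)) = (- 1) ^ i" if "i \<le> k" for i
    using that by (simp add: prod.cong[of "{..<i}" _ _ "\<lambda>_. - 1"])
  have parts: "rev (take i (replicate k (1::nat))) = replicate i 1"
     "drop i (replicate k (1::nat)) = replicate (k - i) 1" if "i \<le> k" for i
    using that by (simp_all add: min_def)
  show ?thesis
  proof (cases "even k")
    case True
    then have "T_sym (replicate k 1) =
        (\<Sum>i=0..k. smult ((- 1) ^ i) (exp_poly i) * exp_poly (k - i))"
      unfolding T_sym_def length_replicate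
      by (auto intro!: sum.cong simp: sign parts T_sh_replicate_1 simp del: rev_replicate take_replicate drop_replicate One_nat_def)
    then show ?thesis using True by (simp only: exp_poly_convolution if_True)
  next
    case False
    then have "T_sym (replicate k 1) =
        (\<Sum>i=0..k. smult ((- 1) ^ i) (S_poly i * exp_poly (k - i)))"
      unfolding T_sym_def length_replicate
      by (auto intro!: sum.cong simp: sign parts T_sh_replicate_1 S_sh_replicate_1 simp del: rev_replicate take_replicate drop_replicate One_nat_def)
    then show ?thesis using False by (simp only: S_poly_convolution if_False)
  qed
qed

section \<open>Symmetric values in depth one\<close>

text \<open>
  Both last forms of depth one are treated at once: \<open>\<sigma> = - 1\<close> gives \<open>\<omega>\<^sub>-\<^sub>1\<close> and \<open>\<sigma> = 1\<close> gives \<open>\<omega>\<^sub>1\<close>, and the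
  antiderivatives are \<open>Li\<^sub>j(t) + \<sigma> Li\<^sub>j(-t)\<close>. For \<open>k \<ge> 2\<close> they are continuous up to \<open>t = 1\<close>, so the regularized
  value is the value there.
\<close>

lemma reg_poly_depth_1:
  fixes \<sigma> :: real
  assumes [measurable]: "g \<in> borel_measurable borel"
    and g0: "\<And>t. 0 < t \<Longrightarrow> t < 1 \<Longrightarrow> 0 \<le> g t"
    and g: "\<And>t. 0 < t \<Longrightarrow> t < 1 \<Longrightarrow> g t = 1 / (1 - t) - \<sigma> / (1 + t)"
    and "k \<ge> 2"
  shows "reg_poly (replicate (k - 1) omega_0 @ [g]) = [:zeta k + \<sigma> * polylog k (- 1):]"
proof (rule reg_poly_of_antiderivative)
  define G where "G = (\<lambda>j t. polylog (Suc j) t + \<sigma> * polylog (Suc j) (- t))"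
  have deriv: "(G j has_real_derivative omega_0 t * (polylog j t + \<sigma> * polylog j (- t))) (at t)"
    if "0 < t" "t < 1" for j t
  proof -
    have m: "(uminus has_real_derivative - 1) (at t)"
      by (auto intro!: derivative_eq_intros)
    have "((\<lambda>t. polylog (Suc j) (- t)) has_real_derivative polylog j (- t) / (- t) * (- 1)) (at t)"
      by (rule DERIV_chain2[OF polylog_deriv m]) (use that in auto)
    then have "(G j has_real_derivative polylog j t / t + \<sigma> * (polylog j (- t) / (- t) * (- 1))) (at t)"
      unfolding G_def by (intro DERIV_add DERIV_cmult polylog_deriv) (use that in auto)
    then show ?thesis by (simp add: omega_0_def add_divide_distrib)
  qed
  fix x :: real assume x: "0 < x" "x < 1"
  have "iter_integral (replicate (k - 1) omega_0 @ [g]) x = G (k - 1) x"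
  proof (rule iter_integral_replicate_append)
    show "continuous_on {0..x} (G j)" for j
      unfolding G_def
    proof (intro continuous_intros)
      show "continuous_on {0..x} (polylog (Suc j))"
        by (rule continuous_on_subset[OF continuous_on_polylog]) (use x in auto)
      show "continuous_on {0..x} (\<lambda>t. polylog (Suc j) (- t))"
        by (rule continuous_on_compose2[OF continuous_on_polylog]) (use x in \<open>auto intro!: continuous_intros\<close>)
    qed
    fix t assume t: "0 < t" "t < x"
    have "omega_0 t * (polylog 0 t + \<sigma> * polylog 0 (- t)) = g t"
      using t x by (simp add: g polylog_0 omega_0_def add_divide_distrib diff_divide_distrib distrib_left)
    then show "(G 0 has_real_derivative g t) (at t)"
      using deriv[of t 0] t x by simp
    show "(G (Suc j) has_real_derivative omega_0 t * G j t) (at t)" for j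
      using deriv[of t "Suc j"] t x by (simp add: G_def)
  qed (use x in \<open>auto simp: G_def intro!: omega_nonneg g0\<close>)
  then show "iter_integral (replicate (k - 1) omega_0 @ [g]) x = polylog k x + \<sigma> * polylog k (- x)"
    using assms(4) by (simp add: G_def)
next
  have c: "continuous_on {0..1} (\<lambda>\<epsilon>. polylog k (1 - \<epsilon>) + \<sigma> * polylog k (- (1 - \<epsilon>)))"
    by (intro continuous_intros continuous_on_compose2[OF continuous_on_polylog_ge_2[OF assms(4)]]) auto
  have "((\<lambda>\<epsilon>. polylog k (1 - \<epsilon>) + \<sigma> * polylog k (- (1 - \<epsilon>))) \<longlongrightarrow> polylog k 1 + \<sigma> * polylog k (- 1)) (at_right 0)"
    using bspec[OF c[unfolded continuous_on_def], of 0] by (simp add: at_within_Icc_at_right)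
  then have "((\<lambda>\<epsilon>. polylog k (1 - \<epsilon>) + \<sigma> * polylog k (- (1 - \<epsilon>)) - (polylog k 1 + \<sigma> * polylog k (- 1)))
     \<longlongrightarrow> 0) (at_right 0)"
    by (rule LIM_zero)
  then show "((\<lambda>\<epsilon>. polylog k (1 - \<epsilon>) + \<sigma> * polylog k (- (1 - \<epsilon>)) -
      poly [:zeta k + \<sigma> * polylog k (- 1):] (- ln \<epsilon>)) \<longlongrightarrow> 0) (at_right 0)"
    by (simp add: polylog_at_1)
qed

lemma T_sh_depth_1:
  assumes "k \<ge> 2"
  shows "T_sh [k] = [:zeta k - polylog k (- 1):]"
proof -
  have "omega_minus_1 t = 1 / (1 - t) - (- 1) / (1 + t)" if "0 < t" "t < 1" for t
  proof -
    have "1 - t\<^sup>2 = (1 + t) * (1 - t)" by (simp add: power2_eq_square algebra_simps)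
    then show ?thesis using that by (simp add: omega_minus_1_def field_simps)
  qed
  from reg_poly_depth_1[OF _ _ this assms] show ?thesis
    by (simp add: T_sh_def word_T_def omega_nonneg)
qed

lemma S_sh_depth_1:
  assumes "k \<ge> 2"
  shows "S_sh [k] = [:zeta k + polylog k (- 1):]"
proof -
  have "omega_1 t = 1 / (1 - t) - 1 / (1 + t)" if "0 < t" "t < 1" for t
  proof -
    have "1 - t\<^sup>2 = (1 + t) * (1 - t)" by (simp add: power2_eq_square algebra_simps)
    then show ?thesis using that by (simp add: omega_1_def field_simps)
  qed
  from reg_poly_depth_1[OF _ _ this assms] show ?thesis
    by (simp add: S_sh_def word_S_def word_T_def omega_nonneg)
qed

lemma T_sym_depth_1:
  assumes "k \<ge> 2"
  shows "T_sym [k] = (if even k then [:2 * zeta k:] else [:- 2 * polylog k (- 1):])"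
  using T_sh_depth_1[OF assms] S_sh_depth_1[OF assms]
  by (auto simp: T_sym_def S_sh_def[of "[]"] T_sh_def[of "[]"] atLeast0_atMost_Suc)

section \<open>Evaluation and congruence\<close>

theorem theorem2p3:
  fixes k :: nat
  assumes "k \<ge> 1"
  shows "T_sym (replicate k 1) =
           (if even k then 0
            else if k = 1 then [:2 * ln 2:]
            else [:2 * (1 - 2 powi (1 - int k)) * zeta k:])
         \<and> cong_zeta2 (T_sym (replicate k 1)) (T_sym [k]) (ES1 (int k - 2))"
proof
  show "T_sym (replicate k 1) =
           (if even k then 0
            else if k = 1 then [:2 * ln 2:]
            else [:2 * (1 - 2 powi (1 - int k)) * zeta k:])"
  proof (cases "k = 1")
    case True
    have "polylog 1 (- 1) = - ln 2" using polylog_1[of "- 1"] by simp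
    then show ?thesis unfolding T_sym_replicate_1 by (simp add: True sym_const_def)
  next
    case False
    then show ?thesis
      using assms polylog_at_minus_1[of k] unfolding T_sym_replicate_1
      by (auto simp: sym_const_def algebra_simps)
  qed
  have "\<exists>v\<in>ES1 (int k - 2). T_sym (replicate k 1) - T_sym [k] = [:zeta 2 * v:]"
  proof (cases "odd k")
    case True
    have "T_sym (replicate k 1) = T_sym [k]"
    proof (cases "k = 1")
      case False
      with True assms have "k \<ge> 2" by simp
      with True show ?thesis unfolding T_sym_replicate_1 by (simp add: T_sym_depth_1 sym_const_def)
    qed simp
    moreover have "0 \<in> ES1 (int k - 2)"
      by (auto simp: ES1_def intro!: exI[of _ 0])
    ultimately show ?thesis by (intro bexI[of _ 0]) auto
  next
    case False
    with assms obtain n where n: "k = 2 * n" "n \<ge> 1" by (auto elim!: evenE)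
    then have diff: "T_sym (replicate k 1) - T_sym [k] = [:- 2 * zeta (2 * n):]"
      unfolding T_sym_replicate_1 by (simp add: T_sym_depth_1)
    show ?thesis
    proof (cases "n = 1")
      case True
      have "- 2 \<in> ES1 (int k - 2)" using n True by (simp add: ES1_def)
      then show ?thesis unfolding diff using True by (intro bexI[of _ "- 2"]) auto
    next
      case False
      with n have n2: "n \<ge> 2" by simp
      then obtain q where q: "q \<in> \<rat>" "zeta (2 * n) = zeta 2 * (q * zeta (2 * n - 2))"
        using zeta_even_ratio by blast
      have "nat (int k - 2) = 2 * n - 2" using n n2 by simp
      moreover have "- 2 * q \<in> \<rat>" using q(1) by simp
      ultimately have "(- 2 * q) * zeta (2 * n - 2) \<in> ES1 (int k - 2)"
        using n n2 unfolding ES1_def by (auto intro!: exI[of _ "- 2 * q"])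
      then show ?thesis unfolding diff using q(2)
        by (intro bexI[of _ "(- 2 * q) * zeta (2 * n - 2)"]) auto
    qed
  qed
  then show "cong_zeta2 (T_sym (replicate k 1)) (T_sym [k]) (ES1 (int k - 2))"
    unfolding cong_zeta2_def by blast
qed

end
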